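(* Let $G$ be a finite group acting linearly on a finite-dimensional vector space $V$ over a field $k$ whose characteristic is coprime to $|G|$ (that is, the characteristic of $k$ is $0$ or a prime not dividing $|G|$). If the algebra $\mathcal{H}_{\lambda,0}$ exhibits the PBW property for some $k$-linear parameter $\lambda: kG\otimes V\to kG$, then there exists an alternating $k$-linear parameter $\kappa: V\otimes V\to kG$ with $$\mathcal{H}_{0,\kappa}\cong\mathcal{H}_{\lambda,0}$$ as filtered algebras.
   Context: Notation: $\otimes=\otimes_k$; ${}^gv$ denotes the action of $g\in G$ on $v$; $\lambda(g,v)=\lambda(g\otimes v)$ and $\kappa(v,w)=\kappa(v\otimes w)$. The skew group algebra $S(V)\# G$ is the vector space $S(V)\otimes kG$ with product $(r\otimes g)(s\otimes h)=r({}^gs)\otimes gh$. For $k$-linear maps $\lambda:kG\otimes V\to kG$ and $\kappa:V\otimes V\to kG$ with $\kappa$ alternating, $\mathcal{H}_{\lambda,\kappa}$ is the associative unital $k$-algebra generated by a basis of $V$ together with the group algebra $kG$, subject to the relations in $kG$ and $vw-wv=\kappa(v,w)$, $gv-{}^gv\,g=\lambda(g,v)$ for all $v,w\in V$, $g\in G$. Thus $\mathcal{H}_{\lambda,0}$ is the case $\kappa\equiv 0$ and $\mathcal{H}_{0,\kappa}$ is the case $\lambda\equiv 0$. The algebra is filtered by $\deg v=1$ for $v\in V$ and $\deg g=0$ for $g\in G$. It exhibits the Poincaré–Birkhoff–Witt (PBW) property when $\mathrm{gr}(\mathcal{H}_{\lambda,\kappa})\cong S(V)\# G$ as graded algebras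 ($S(V)\# G$ graded with $V$ in degree 1 and $G$ in degree 0); equivalently, when $\{v_1^{i_1}\cdots v_m^{i_m}g: i_j\in\mathbb{Z}_{\ge 0},\ g\in G\}$ is a $k$-basis for $v_1,\dots,v_m$ any basis of $V$. *)

theory Defs
  imports
    Complex_Main
    "HOL-Library.Poly_Mapping"
    "HOL-Algebra.QuotRing"
    "HOL-Algebra.Module"
    "HOL-Algebra.Group_Action"
begin

section \<open>Algebras over a field, filtrations and gradings\<close>

text \<open>
  The ground field is a type \<open>'k\<close> of class \<open>field\<close>. Algebras over it are records of type
  \<open>('k, 'a) module\<close>, i.e. HOL-Algebra rings with a scalar multiplication \<open>\<odot>\<close>. Filtrations and
  gradings are indexed by the natural numbers and given as families of subsets of the carrier.
\<close>

text \<open>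
  Isomorphism of algebras carrying each member of one family of subspaces onto the corresponding
  member of the other. For increasing families this is an isomorphism of filtered algebras, for
  families of homogeneous components an isomorphism of graded algebras.
\<close>

definition alg_fam_iso ::
    "('k, 'a) module \<Rightarrow> (nat \<Rightarrow> 'a set) \<Rightarrow> ('k, 'b) module \<Rightarrow> (nat \<Rightarrow> 'b set) \<Rightarrow> bool" where
  "alg_fam_iso A FA B FB \<longleftrightarrow>
     (\<exists>h \<in> ring_iso A B.
        (\<forall>c. \<forall>x \<in> carrier A. h (c \<odot>\<^bsub>A\<^esub> x) = c \<odot>\<^bsub>B\<^esub> h x) \<and>
        (\<forall>n. h ` FA n = FB n))"

definition quot_alg :: "('k, 'a) module \<Rightarrow> 'a set \<Rightarrow> ('k, 'a set) module" where
  "quot_alg A I = ring.extend (A Quot I)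
     (module.fields (\<lambda>c X. I <+>\<^bsub>A\<^esub> (\<lambda>x. c \<odot>\<^bsub>A\<^esub> x) ` X))"

text \<open>
  The associated graded algebra, the direct sum of the \<open>F n / F (n - 1)\<close> with \<open>F (- 1) = 0\<close>.
  An element is a finitely supported sequence whose \<open>n\<close>-th entry is a coset of \<open>F (n - 1)\<close> in
  \<open>F n\<close>. The entries of a product are written without choosing representatives: the set below
  is the coset of \<open>F (n - 1)\<close> that contains all the sums of products of representatives.
\<close>

definition below :: "('k, 'a) module \<Rightarrow> (nat \<Rightarrow> 'a set) \<Rightarrow> nat \<Rightarrow> 'a set" where
  "below A F n = (if n = 0 then {\<zero>\<^bsub>A\<^esub>} else F (n - 1))"

definition gr_alg :: "('k, 'a) module \<Rightarrow> (nat \<Rightarrow> 'a set) \<Rightarrow> ('k, nat \<Rightarrow> 'a set) module" where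
  "gr_alg A F =
     \<lparr>carrier = {x. (\<forall>n. \<exists>a \<in> F n. x n = below A F n +>\<^bsub>A\<^esub> a) \<and>
                    finite {n. x n \<noteq> below A F n}},
      mult = (\<lambda>x y n. {z \<oplus>\<^bsub>A\<^esub> (\<Oplus>\<^bsub>A\<^esub>i\<in>{..n}. a i \<otimes>\<^bsub>A\<^esub> b (n - i)) | z a b.
                        z \<in> below A F n \<and> (\<forall>i\<le>n. a i \<in> x i \<and> b i \<in> y i)}),
      one = (\<lambda>n. if n = 0 then {\<one>\<^bsub>A\<^esub>} else below A F n),
      zero = below A F,
      add = (\<lambda>x y n. x n <+>\<^bsub>A\<^esub> y n),
      smult = (\<lambda>c x n. below A F n <+>\<^bsub>A\<^esub> (\<lambda>a. c \<odot>\<^bsub>A\<^esub> a) ` x n)\<rparr>"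

definition gr_comp :: "('k, 'a) module \<Rightarrow> (nat \<Rightarrow> 'a set) \<Rightarrow> nat \<Rightarrow> (nat \<Rightarrow> 'a set) set" where
  "gr_comp A F n = {x \<in> carrier (gr_alg A F). \<forall>m. m \<noteq> n \<longrightarrow> x m = below A F m}"


section \<open>Free algebras\<close>

text \<open>
  Words over an alphabet, as an additive monoid under concatenation, so that the convolution
  product of \<^theory>\<open>HOL-Library.Poly_Mapping\<close> makes \<open>'x fword \<Rightarrow>\<^sub>0 'k\<close> the free associative
  unital algebra on \<open>'x\<close>.
\<close>

datatype 'x fword = FWord (letters: "'x list")

instantiation fword :: (type) monoid_add
begin

definition zero_fword :: "'x fword" where
  "zero_fword = FWord []"

definition plus_fword :: "'x fword \<Rightarrow> 'x fword \<Rightarrow> 'x fword" where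
  "plus_fword u w = FWord (letters u @ letters w)"

instance
  by standard (auto simp: zero_fword_def plus_fword_def)

end

definition pm_scale :: "'k \<Rightarrow> ('a \<Rightarrow>\<^sub>0 'k) \<Rightarrow> ('a \<Rightarrow>\<^sub>0 'k::semiring_0)" where
  "pm_scale c p = Poly_Mapping.map (\<lambda>x. c * x) p"

lemma lookup_pm_scale [simp]:
  "Poly_Mapping.lookup (pm_scale c p) x = c * Poly_Mapping.lookup p x"
  by (simp add: pm_scale_def Poly_Mapping.map.rep_eq when_def)

lemma vector_space_pm_scale: "vector_space (pm_scale :: 'k::field \<Rightarrow> ('a \<Rightarrow>\<^sub>0 'k) \<Rightarrow> _)"
  by unfold_locales (auto intro!: poly_mapping_eqI simp: lookup_add algebra_simps)

definition free_alg :: "'x set \<Rightarrow> ('k::field, 'x fword \<Rightarrow>\<^sub>0 'k) module" where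
  "free_alg X =
     \<lparr>carrier = {p. \<forall>w \<in> Poly_Mapping.keys p. set (letters w) \<subseteq> X},
      mult = (*), one = 1, zero = 0, add = (+), smult = pm_scale\<rparr>"


section \<open>The parameters\<close>

text \<open>
  The vector space underlying the group algebra \<open>kG\<close>, consisting of formal linear combinations
  of elements of \<open>G\<close>. Linear maps out of a tensor product are rendered as bilinear maps.
\<close>

definition kG :: "('g, 'm) monoid_scheme \<Rightarrow> ('g \<Rightarrow>\<^sub>0 'k::field) set" where
  "kG G = {a. Poly_Mapping.keys a \<subseteq> carrier G}"

definition lambda_param ::
    "('g, 'm) monoid_scheme \<Rightarrow> ('k::field \<Rightarrow> 'v::ab_group_add \<Rightarrow> 'v) \<Rightarrow>
     (('g \<Rightarrow>\<^sub>0 'k) \<Rightarrow> 'v \<Rightarrow> ('g \<Rightarrow>\<^sub>0 'k)) \<Rightarrow> bool" where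
  "lambda_param G scale lam \<longleftrightarrow>
     (\<forall>a \<in> kG G. \<forall>v. lam a v \<in> kG G) \<and>
     (\<forall>a \<in> kG G. Vector_Spaces.linear scale pm_scale (lam a)) \<and>
     (\<forall>a \<in> kG G. \<forall>b \<in> kG G. \<forall>v. lam (a + b) v = lam a v + lam b v) \<and>
     (\<forall>c. \<forall>a \<in> kG G. \<forall>v. lam (pm_scale c a) v = pm_scale c (lam a v))"

definition kappa_param ::
    "('g, 'm) monoid_scheme \<Rightarrow> ('k::field \<Rightarrow> 'v::ab_group_add \<Rightarrow> 'v) \<Rightarrow>
     ('v \<Rightarrow> 'v \<Rightarrow> ('g \<Rightarrow>\<^sub>0 'k)) \<Rightarrow> bool" where
  "kappa_param G scale kap \<longleftrightarrow>
     (\<forall>v w. kap v w \<in> kG G) \<and>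
     (\<forall>v. Vector_Spaces.linear scale pm_scale (kap v)) \<and>
     (\<forall>w. Vector_Spaces.linear scale pm_scale (\<lambda>v. kap v w)) \<and>
     (\<forall>v. kap v v = 0)"


section \<open>The algebra \<open>\<H>\<^sub>\<lambda>\<^sub>,\<^sub>\<kappa>\<close>\<close>

text \<open>
  Generators are \<open>Inl b\<close> for \<open>b\<close> in the chosen basis \<open>B\<close> of \<open>V\<close> and \<open>Inr g\<close> for \<open>g \<in> G\<close>.
\<close>

definition gens :: "('g, 'm) monoid_scheme \<Rightarrow> 'v set \<Rightarrow> ('v + 'g) set" where
  "gens G B = Inl ` B \<union> Inr ` carrier G"

definition in_vec ::
    "('k::field \<Rightarrow> 'v::ab_group_add \<Rightarrow> 'v) \<Rightarrow> 'v set \<Rightarrow> 'v \<Rightarrow> (('v + 'g) fword \<Rightarrow>\<^sub>0 'k)" where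
  "in_vec scale B v =
     (\<Sum>b\<in>B. Poly_Mapping.single (FWord [Inl b]) (module.representation scale B v b))"

definition in_grp :: "'g \<Rightarrow> (('v + 'g) fword \<Rightarrow>\<^sub>0 'k::field)" where
  "in_grp g = Poly_Mapping.single (FWord [Inr g]) 1"

definition in_kG :: "('g \<Rightarrow>\<^sub>0 'k::field) \<Rightarrow> (('v + 'g) fword \<Rightarrow>\<^sub>0 'k)" where
  "in_kG a = (\<Sum>g\<in>Poly_Mapping.keys a. pm_scale (Poly_Mapping.lookup a g) (in_grp g))"

definition relators ::
    "('g, 'm) monoid_scheme \<Rightarrow> ('k::field \<Rightarrow> 'v::ab_group_add \<Rightarrow> 'v) \<Rightarrow> 'v set \<Rightarrow>
     ('g \<Rightarrow> 'v \<Rightarrow> 'v) \<Rightarrow> (('g \<Rightarrow>\<^sub>0 'k) \<Rightarrow> 'v \<Rightarrow> ('g \<Rightarrow>\<^sub>0 'k)) \<Rightarrow> ('v \<Rightarrow> 'v \<Rightarrow> ('g \<Rightarrow>\<^sub>0 'k)) \<Rightarrow>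
     (('v + 'g) fword \<Rightarrow>\<^sub>0 'k) set" where
  "relators G scale B act lam kap =
     {in_grp \<one>\<^bsub>G\<^esub> - 1} \<union>
     {in_grp g * in_grp h - in_grp (g \<otimes>\<^bsub>G\<^esub> h) | g h. g \<in> carrier G \<and> h \<in> carrier G} \<union>
     {in_vec scale B v * in_vec scale B w - in_vec scale B w * in_vec scale B v
        - in_kG (kap v w) | v w. True} \<union>
     {in_grp g * in_vec scale B v - in_vec scale B (act g v) * in_grp g
        - in_kG (lam (Poly_Mapping.single g 1) v) | g v. g \<in> carrier G}"

definition rel_ideal ::
    "('g, 'm) monoid_scheme \<Rightarrow> ('k::field \<Rightarrow> 'v::ab_group_add \<Rightarrow> 'v) \<Rightarrow> 'v set \<Rightarrow>
     ('g \<Rightarrow> 'v \<Rightarrow> 'v) \<Rightarrow> (('g \<Rightarrow>\<^sub>0 'k) \<Rightarrow> 'v \<Rightarrow> ('g \<Rightarrow>\<^sub>0 'k)) \<Rightarrow> ('v \<Rightarrow> 'v \<Rightarrow> ('g \<Rightarrow>\<^sub>0 'k)) \<Rightarrow>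
     (('v + 'g) fword \<Rightarrow>\<^sub>0 'k) set" where
  "rel_ideal G scale B act lam kap =
     Idl\<^bsub>(free_alg (gens G B) :: ('k, ('v + 'g) fword \<Rightarrow>\<^sub>0 'k) module)\<^esub>
       (relators G scale B act lam kap)"

definition H_alg ::
    "('g, 'm) monoid_scheme \<Rightarrow> ('k::field \<Rightarrow> 'v::ab_group_add \<Rightarrow> 'v) \<Rightarrow> 'v set \<Rightarrow>
     ('g \<Rightarrow> 'v \<Rightarrow> 'v) \<Rightarrow> (('g \<Rightarrow>\<^sub>0 'k) \<Rightarrow> 'v \<Rightarrow> ('g \<Rightarrow>\<^sub>0 'k)) \<Rightarrow> ('v \<Rightarrow> 'v \<Rightarrow> ('g \<Rightarrow>\<^sub>0 'k)) \<Rightarrow>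
     ('k, (('v + 'g) fword \<Rightarrow>\<^sub>0 'k) set) module" where
  "H_alg G scale B act lam kap =
     quot_alg (free_alg (gens G B)) (rel_ideal G scale B act lam kap)"

definition vdeg :: "('v + 'g) fword \<Rightarrow> nat" where
  "vdeg w = length (filter isl (letters w))"

definition H_filt ::
    "('g, 'm) monoid_scheme \<Rightarrow> ('k::field \<Rightarrow> 'v::ab_group_add \<Rightarrow> 'v) \<Rightarrow> 'v set \<Rightarrow>
     ('g \<Rightarrow> 'v \<Rightarrow> 'v) \<Rightarrow> (('g \<Rightarrow>\<^sub>0 'k) \<Rightarrow> 'v \<Rightarrow> ('g \<Rightarrow>\<^sub>0 'k)) \<Rightarrow> ('v \<Rightarrow> 'v \<Rightarrow> ('g \<Rightarrow>\<^sub>0 'k)) \<Rightarrow>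
     nat \<Rightarrow> (('v + 'g) fword \<Rightarrow>\<^sub>0 'k) set set" where
  "H_filt G scale B act lam kap n =
     {rel_ideal G scale B act lam kap
        +>\<^bsub>(free_alg (gens G B) :: ('k, ('v + 'g) fword \<Rightarrow>\<^sub>0 'k) module)\<^esub> p | p.
      p \<in> carrier (free_alg (gens G B)) \<and> (\<forall>w \<in> Poly_Mapping.keys p. vdeg w \<le> n)}"


section \<open>The skew group algebra \<open>S(V) # G\<close>\<close>

text \<open>
  \<open>S(V)\<close> is the polynomial algebra on the elements of the basis \<open>B\<close>, with monomials as
  multisets of type \<open>'v \<Rightarrow>\<^sub>0 nat\<close>; \<open>G\<close> acts on it by algebra automorphisms extending the action on
  \<open>V\<close>. An element of \<open>S(V) \<otimes> kG\<close> is given by its coefficients in \<open>S(V)\<close> at the elements of \<open>G\<close>.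
\<close>

type_synonym ('v, 'k) sym = "('v \<Rightarrow>\<^sub>0 nat) \<Rightarrow>\<^sub>0 'k"

definition Sym :: "'v set \<Rightarrow> ('v, 'k::field) sym set" where
  "Sym B = {p. \<forall>m \<in> Poly_Mapping.keys p. Poly_Mapping.keys m \<subseteq> B}"

definition sym_vec ::
    "('k::field \<Rightarrow> 'v::ab_group_add \<Rightarrow> 'v) \<Rightarrow> 'v set \<Rightarrow> 'v \<Rightarrow> ('v, 'k) sym" where
  "sym_vec scale B v =
     (\<Sum>b\<in>B. Poly_Mapping.single (Poly_Mapping.single b 1) (module.representation scale B v b))"

definition sym_act ::
    "('k::field \<Rightarrow> 'v::ab_group_add \<Rightarrow> 'v) \<Rightarrow> 'v set \<Rightarrow> ('v \<Rightarrow> 'v) \<Rightarrow>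
     ('v, 'k) sym \<Rightarrow> ('v, 'k) sym" where
  "sym_act scale B f p =
     (\<Sum>m\<in>Poly_Mapping.keys p. pm_scale (Poly_Mapping.lookup p m)
        (\<Prod>b\<in>Poly_Mapping.keys m. sym_vec scale B (f b) ^ Poly_Mapping.lookup m b))"

definition mdeg :: "('v \<Rightarrow>\<^sub>0 nat) \<Rightarrow> nat" where
  "mdeg m = (\<Sum>b\<in>Poly_Mapping.keys m. Poly_Mapping.lookup m b)"

definition skew_alg ::
    "('g, 'm) monoid_scheme \<Rightarrow> ('k::field \<Rightarrow> 'v::ab_group_add \<Rightarrow> 'v) \<Rightarrow> 'v set \<Rightarrow>
     ('g \<Rightarrow> 'v \<Rightarrow> 'v) \<Rightarrow> ('k, 'g \<Rightarrow>\<^sub>0 ('v, 'k) sym) module" where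
  "skew_alg G scale B act =
     \<lparr>carrier = {f. Poly_Mapping.keys f \<subseteq> carrier G \<and> (\<forall>g. Poly_Mapping.lookup f g \<in> Sym B)},
      mult = (\<lambda>f f'. \<Sum>g\<in>Poly_Mapping.keys f. \<Sum>h\<in>Poly_Mapping.keys f'.
                Poly_Mapping.single (g \<otimes>\<^bsub>G\<^esub> h)
                  (Poly_Mapping.lookup f g *
                   sym_act scale B (act g) (Poly_Mapping.lookup f' h))),
      one = Poly_Mapping.single \<one>\<^bsub>G\<^esub> 1,
      zero = 0,
      add = (+),
      smult = (\<lambda>c. Poly_Mapping.map (pm_scale c))\<rparr>"

definition skew_comp ::
    "('g, 'm) monoid_scheme \<Rightarrow> ('k::field \<Rightarrow> 'v::ab_group_add \<Rightarrow> 'v) \<Rightarrow> 'v set \<Rightarrow>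
     ('g \<Rightarrow> 'v \<Rightarrow> 'v) \<Rightarrow> nat \<Rightarrow> ('g \<Rightarrow>\<^sub>0 ('v, 'k) sym) set" where
  "skew_comp G scale B act n =
     {f \<in> carrier (skew_alg G scale B act).
        \<forall>g. \<forall>m \<in> Poly_Mapping.keys (Poly_Mapping.lookup f g). mdeg m = n}"


section \<open>The PBW property\<close>

definition PBW ::
    "('g, 'm) monoid_scheme \<Rightarrow> ('k::field \<Rightarrow> 'v::ab_group_add \<Rightarrow> 'v) \<Rightarrow> 'v set \<Rightarrow>
     ('g \<Rightarrow> 'v \<Rightarrow> 'v) \<Rightarrow> (('g \<Rightarrow>\<^sub>0 'k) \<Rightarrow> 'v \<Rightarrow> ('g \<Rightarrow>\<^sub>0 'k)) \<Rightarrow> ('v \<Rightarrow> 'v \<Rightarrow> ('g \<Rightarrow>\<^sub>0 'k)) \<Rightarrow>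
     bool" where
  "PBW G scale B act lam kap \<longleftrightarrow>
     alg_fam_iso
       (gr_alg (H_alg G scale B act lam kap) (H_filt G scale B act lam kap))
       (gr_comp (H_alg G scale B act lam kap) (H_filt G scale B act lam kap))
       (skew_alg G scale B act)
       (skew_comp G scale B act)"

end

theory Submission
  imports Defs
begin

text \<open>
  Averaging over \<open>G\<close> makes the generators equivariant: in \<open>\<H>\<^sub>\<lambda>\<^sub>,\<^sub>0\<close> the elements
  \<open>|G|\<^sup>-\<^sup>1 \<Sum>\<^sub>g g\<^sup>-\<^sup>1 (g v) g = v + \<gamma>(v)\<close>, with \<open>\<gamma>(v) \<in> kG\<close>, satisfy
  \<open>h (v + \<gamma>(v)) = (h v + \<gamma>(h v)) h\<close>. Comparing both sides of \<open>g v w = g w v\<close> in degree one gives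
  \<open>\<gamma>\<^sub>a(v) (a w - w) = \<gamma>\<^sub>a(w) (a v - v)\<close> for the coefficients of \<open>\<gamma>\<close>, and then the shifted
  generators have commutator \<open>\<kappa>(v, w) = \<gamma>(w) \<gamma>(v) - \<gamma>(v) \<gamma>(w)\<close>. So the automorphism
  \<open>v \<mapsto> v + \<gamma>(v)\<close>, \<open>g \<mapsto> g\<close> of the free algebra, with inverse \<open>v \<mapsto> v - \<gamma>(v)\<close>, carries the
  ideal of relations of \<open>\<H>\<^sub>0\<^sub>,\<^sub>\<kappa>\<close> onto that of \<open>\<H>\<^sub>\<lambda>\<^sub>,\<^sub>0\<close>. The PBW property enters only through the
  linear independence of the elements \<open>g\<close> in degree zero and \<open>b g\<close> in degree one, which follows by
  counting dimensions.
\<close>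

subsection \<open>Free algebras and substitution\<close>

interpretation pm: vector_space "pm_scale :: 'k::field \<Rightarrow> ('a \<Rightarrow>\<^sub>0 'k) \<Rightarrow> _"
  by (rule vector_space_pm_scale)

lemma pm_scale_conv_mult: "pm_scale c p = Poly_Mapping.single 0 c * p"
  for p :: "'a::monoid_add \<Rightarrow>\<^sub>0 'k::field"
  by (simp add: pm_scale_def mult_map_scale_conv_mult)

lemma pm_scale_mult_left: "pm_scale c p * q = pm_scale c (p * q)"
  for p :: "'a::monoid_add \<Rightarrow>\<^sub>0 'k::field"
  by (simp add: pm_scale_conv_mult mult.assoc)

text \<open>Every finitely supported function is a finite sum of monomials, so identities that are
  linear in an argument need only be checked on \<open>single\<close>.\<close>

lemma pm_induct [case_names single add]:
  assumes "\<And>k c. P (Poly_Mapping.single k c)" and "\<And>p q. P p \<Longrightarrow> P q \<Longrightarrow> P (p + q)"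
  shows "P (p :: 'a \<Rightarrow>\<^sub>0 'k::comm_monoid_add)"
proof -
  have *: "P (\<Sum>k\<in>S. Poly_Mapping.single k (Poly_Mapping.lookup p k))" if "finite S" for S
    using that
  proof induction
    case empty
    \<comment> \<open>The empty sum is a monomial with coefficient 0, at an arbitrary key.\<close>
    show ?case using assms(1)[of undefined 0] by simp
  qed (simp add: assms)
  have "p = (\<Sum>k\<in>Poly_Mapping.keys p. Poly_Mapping.single k (Poly_Mapping.lookup p k))"
    by (rule poly_mapping_eqI) (simp add: lookup_sum lookup_single when_def in_keys_iff sum.delta)
  with *[of "Poly_Mapping.keys p"] show ?thesis by simp
qed

lemma pm_scale_single [simp]:
  "pm_scale c (Poly_Mapping.single k d) = Poly_Mapping.single k (c * d)"
  by (rule poly_mapping_eqI) (simp add: lookup_single when_def)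

lemma pm_scale_mult_right: "p * pm_scale c q = pm_scale c (p * q)"
  for p :: "'a::monoid_add \<Rightarrow>\<^sub>0 'k::field"
proof (induction p rule: pm_induct)
  case (single k d)
  show ?case
    by (induction q rule: pm_induct)
      (simp_all add: mult_single ac_simps pm.scale_right_distrib distrib_left)
qed (simp add: distrib_right pm.scale_right_distrib)

lemma keys_pm_scale: "Poly_Mapping.keys (pm_scale c p) \<subseteq> Poly_Mapping.keys p"
  for p :: "'a \<Rightarrow>\<^sub>0 'k::field"
  by (auto simp: in_keys_iff)

lemma keys_minus_subset: "Poly_Mapping.keys (p - q) \<subseteq> Poly_Mapping.keys p \<union> Poly_Mapping.keys q"
  for p :: "'a \<Rightarrow>\<^sub>0 'k::ab_group_add"
  by (auto simp: in_keys_iff lookup_minus)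

lemma letters_plus [simp]: "letters (u + w) = letters u @ letters w"
  by (simp add: plus_fword_def)

lemma letters_zero [simp]: "letters 0 = []"
  by (simp add: zero_fword_def)

lemma vdeg_plus [simp]: "vdeg (u + w) = vdeg u + vdeg w"
  by (simp add: vdeg_def)

lemma vdeg_zero [simp]: "vdeg 0 = 0"
  by (simp add: vdeg_def)

lemma free_alg_simps [simp]:
  "mult (free_alg X) = (*)" "one (free_alg X) = 1" "zero (free_alg X) = 0"
  "add (free_alg X) = (+)" "smult (free_alg X) = pm_scale"
  by (simp_all add: free_alg_def)

lemma mem_free_alg:
  "p \<in> carrier (free_alg X) \<longleftrightarrow> (\<forall>w \<in> Poly_Mapping.keys p. set (letters w) \<subseteq> X)"
  by (simp add: free_alg_def)

lemma free_alg_closed: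
  "p \<in> carrier (free_alg X) \<Longrightarrow> q \<in> carrier (free_alg X) \<Longrightarrow> p + q \<in> carrier (free_alg X)"
  "p \<in> carrier (free_alg X) \<Longrightarrow> q \<in> carrier (free_alg X) \<Longrightarrow> p - q \<in> carrier (free_alg X)"
  "p \<in> carrier (free_alg X) \<Longrightarrow> q \<in> carrier (free_alg X) \<Longrightarrow> p * q \<in> carrier (free_alg X)"
  "p \<in> carrier (free_alg X) \<Longrightarrow> - p \<in> carrier (free_alg X)"
  "p \<in> carrier (free_alg X) \<Longrightarrow> pm_scale c p \<in> carrier (free_alg X)"
  using keys_add[of p q] keys_minus_subset[of p q] keys_mult[of p q] keys_pm_scale[of c p]
  unfolding mem_free_alg by fastforce+

lemma free_alg_closed_0_1: "0 \<in> carrier (free_alg X)" "1 \<in> carrier (free_alg X)"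
  by (auto simp: mem_free_alg)

lemma free_alg_sum_closed:
  assumes "\<And>i. i \<in> A \<Longrightarrow> f i \<in> carrier (free_alg X)"
  shows "(\<Sum>i\<in>A. f i) \<in> carrier (free_alg X)"
  using assms by (induction A rule: infinite_finite_induct)
    (auto intro: free_alg_closed free_alg_closed_0_1)

lemma ring_free_alg: "ring (free_alg X)"
proof (rule ringI)
  show "abelian_group (free_alg X)"
  proof (rule abelian_groupI)
    fix x assume "x \<in> carrier (free_alg X)"
    then show "\<exists>y\<in>carrier (free_alg X). y \<oplus>\<^bsub>free_alg X\<^esub> x = \<zero>\<^bsub>free_alg X\<^esub>"
      by (intro bexI[of _ "- x"]) (auto intro: free_alg_closed)
  qed (auto intro: free_alg_closed free_alg_closed_0_1 simp: ac_simps)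
  show "Group.monoid (free_alg X)"
    by (rule monoidI) (auto intro: free_alg_closed free_alg_closed_0_1 simp: mult.assoc)
qed (auto simp: algebra_simps)

text \<open>The homomorphism given by the universal property of the free algebra: it extends
  \<open>s\<close> from letters to all polynomials.\<close>

definition subst :: "('x \<Rightarrow> ('y fword \<Rightarrow>\<^sub>0 'k::field)) \<Rightarrow> ('x fword \<Rightarrow>\<^sub>0 'k) \<Rightarrow> ('y fword \<Rightarrow>\<^sub>0 'k)" where
  "subst s p = (\<Sum>w\<in>Poly_Mapping.keys p.
     pm_scale (Poly_Mapping.lookup p w) (prod_list (map s (letters w))))"

text \<open>Words with coefficient 0 contribute nothing, so sums over different supports can be
  moved to one common index set, as additivity requires.\<close>

lemma subst_superset:
  assumes "finite S" "Poly_Mapping.keys p \<subseteq> S"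
  shows "subst s p = (\<Sum>w\<in>S. pm_scale (Poly_Mapping.lookup p w) (prod_list (map s (letters w))))"
  unfolding subst_def using assms by (intro sum.mono_neutral_left) (auto simp: in_keys_iff)

lemma subst_single: "subst s (Poly_Mapping.single w c) = pm_scale c (prod_list (map s (letters w)))"
  by (subst subst_superset[of "{w}"]) auto

lemma subst_add: "subst s (p + q) = subst s p + subst s q"
proof -
  let ?S = "Poly_Mapping.keys p \<union> Poly_Mapping.keys q"
  have "Poly_Mapping.keys (p + q) \<subseteq> ?S" by (rule keys_add)
  then show ?thesis
    by (simp add: subst_superset[of ?S] lookup_add pm.scale_left_distrib sum.distrib)
qed

lemma subst_scale: "subst s (pm_scale c p) = pm_scale c (subst s p)"
  using keys_pm_scale[of c p]
  by (simp add: subst_superset[of "Poly_Mapping.keys p"] pm.scale_sum_right)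

lemma subst_zero [simp]: "subst s 0 = 0"
  by (simp add: subst_def)

lemma subst_uminus: "subst s (- p) = - subst s p"
  using subst_add[of s p "- p"] by (simp add: eq_neg_iff_add_eq_0 add.commute)

lemma subst_diff: "subst s (p - q) = subst s p - subst s q"
  using subst_add[of s p "- q"] by (simp add: subst_uminus)

lemma subst_sum: "subst s (\<Sum>i\<in>A. f i) = (\<Sum>i\<in>A. subst s (f i))"
  by (induction A rule: infinite_finite_induct) (auto simp: subst_add)

lemma subst_one [simp]: "subst s 1 = 1"
  by (simp add: subst_single flip: single_one)

text \<open>Both sides are bilinear, and on words concatenation becomes multiplication of the
  substituted products.\<close>

lemma subst_mult: "subst s (p * q) = subst s p * subst s q"
proof (induction p rule: pm_induct)
  case (single k d)
  show ?case
    by (induction q rule: pm_induct)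
      (simp_all add: mult_single subst_single subst_add distrib_left pm_scale_mult_left
        pm_scale_mult_right mult.commute)
qed (simp add: distrib_right subst_add)

lemma subst_prod_list: "subst s (prod_list ps) = prod_list (map (subst s) ps)"
  by (induction ps) (simp_all add: subst_mult)

lemma subst_subst: "subst t (subst s p) = subst (\<lambda>x. subst t (s x)) p"
  by (induction p rule: pm_induct)
    (simp_all add: subst_single subst_add subst_scale subst_prod_list comp_def)

lemma prod_list_letters: "prod_list (map (\<lambda>x. Poly_Mapping.single (FWord [x]) (1::'k::field)) xs)
    = Poly_Mapping.single (FWord xs) 1"
  by (induction xs) (simp_all add: mult_single plus_fword_def flip: zero_fword_def)

lemma subst_letters: "subst (\<lambda>x. Poly_Mapping.single (FWord [x]) 1) p = p"
  by (induction p rule: pm_induct) (simp_all add: subst_single subst_add prod_list_letters)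

lemma subst_closed:
  assumes "p \<in> carrier (free_alg X)" "\<And>x. x \<in> X \<Longrightarrow> s x \<in> carrier (free_alg Y)"
  shows "subst s p \<in> carrier (free_alg Y)"
proof -
  have "prod_list (map s xs) \<in> carrier (free_alg Y)" if "set xs \<subseteq> X" for xs
    using that by (induction xs) (auto intro: free_alg_closed free_alg_closed_0_1 assms)
  then have "prod_list (map s (letters w)) \<in> carrier (free_alg Y)" if "w \<in> Poly_Mapping.keys p" for w
    using that assms(1) by (simp add: mem_free_alg[of p])
  then show ?thesis
    unfolding subst_def by (intro free_alg_sum_closed free_alg_closed(5))
qed

section \<open>The filtration of the free algebra by the number of letters from
  \<open>V\<close>\<close>

definition deg_le :: "nat \<Rightarrow> (('v + 'g) fword \<Rightarrow>\<^sub>0 'k::field) set" where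
  "deg_le n = {p. \<forall>w \<in> Poly_Mapping.keys p. vdeg w \<le> n}"

lemma deg_le_closed:
  "p \<in> deg_le n \<Longrightarrow> q \<in> deg_le n \<Longrightarrow> p + q \<in> deg_le n"
  "p \<in> deg_le n \<Longrightarrow> q \<in> deg_le n \<Longrightarrow> p - q \<in> deg_le n"
  "p \<in> deg_le n \<Longrightarrow> pm_scale c p \<in> deg_le n"
  using keys_add[of p q] keys_minus_subset[of p q] keys_pm_scale[of c p]
  unfolding deg_le_def by fastforce+

lemma deg_le_0_1: "0 \<in> deg_le n" "1 \<in> deg_le n"
  by (auto simp: deg_le_def)

lemma deg_le_mult: "p \<in> deg_le m \<Longrightarrow> q \<in> deg_le n \<Longrightarrow> p * q \<in> deg_le (m + n)"
  using keys_mult[of p q] unfolding deg_le_def by (fastforce intro: add_mono)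

lemma deg_le_mono: "m \<le> n \<Longrightarrow> p \<in> deg_le m \<Longrightarrow> p \<in> deg_le n"
  by (auto simp: deg_le_def intro: order_trans)

lemma deg_le_sum: "(\<And>i. i \<in> A \<Longrightarrow> f i \<in> deg_le n) \<Longrightarrow> (\<Sum>i\<in>A. f i) \<in> deg_le n"
  by (induction A rule: infinite_finite_induct) (auto intro: deg_le_closed deg_le_0_1)

text \<open>In the image of a word only the letters from \<open>V\<close> contribute a factor of
  degree one, so the degree cannot rise. The polynomial has to lie in the free algebra on
  \<open>X\<close> because \<open>s\<close> is controlled on \<open>X\<close> only.\<close>

lemma subst_deg_le:
  assumes "p \<in> deg_le n" and "p \<in> carrier (free_alg X)"
    and "\<And>x. x \<in> X \<Longrightarrow> s x \<in> deg_le (if isl x then 1 else 0)"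
  shows "subst s p \<in> deg_le n"
proof -
  have prod: "prod_list (map s xs) \<in> deg_le (length (filter isl xs))" if "set xs \<subseteq> X" for xs
    using that
  proof (induction xs)
    case (Cons x xs)
    then show ?case
      using deg_le_mult[OF assms(3)[of x] Cons.IH] by (cases "isl x") auto
  qed (auto intro: deg_le_0_1)
  have "prod_list (map s (letters w)) \<in> deg_le n" if "w \<in> Poly_Mapping.keys p" for w
  proof (rule deg_le_mono)
    show "length (filter isl (letters w)) \<le> n"
      using that assms(1) by (simp add: deg_le_def vdeg_def)
  qed (use that assms(2) prod in \<open>simp add: mem_free_alg\<close>)
  then show ?thesis
    unfolding subst_def by (intro deg_le_sum deg_le_closed(3)) auto
qed

subsection \<open>Quotient algebras\<close>

lemma image_a_r_coset:
  assumes "I \<subseteq> carrier R" "x \<in> carrier R"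
    and "\<And>x y. x \<in> carrier R \<Longrightarrow> y \<in> carrier R \<Longrightarrow> f (x \<oplus>\<^bsub>R\<^esub> y) = f x \<oplus>\<^bsub>S\<^esub> f y"
  shows "f ` (I +>\<^bsub>R\<^esub> x) = f ` I +>\<^bsub>S\<^esub> f x"
  using assms unfolding a_r_coset_def r_coset_def by (auto simp: subset_iff image_UN)

lemma quot_alg_simps:
  "carrier (quot_alg A I) = (\<lambda>x. I +>\<^bsub>A\<^esub> x) ` carrier A"
  "one (quot_alg A I) = I +>\<^bsub>A\<^esub> \<one>\<^bsub>A\<^esub>" "zero (quot_alg A I) = I"
  "mult (quot_alg A I) = rcoset_mult A I"
  "add (quot_alg A I) = set_add A"
  "smult (quot_alg A I) = (\<lambda>c X. I <+>\<^bsub>A\<^esub> (\<lambda>x. c \<odot>\<^bsub>A\<^esub> x) ` X)"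
  by (auto simp: quot_alg_def ring.defs module.defs FactRing_def A_RCOSETS_def RCOSETS_def
      a_r_coset_def)

text \<open>The induced map sends a coset to its direct image under \<open>f\<close>. No
  representatives are chosen, so there is no well-definedness to check, and injectivity is inherited
  from \<open>f\<close> on all subsets of the carrier.\<close>

lemma quot_alg_iso:
  fixes R :: "('k, 'a) module" and S :: "('k, 'b) module"
  assumes "ring R" and f: "f \<in> ring_iso R S"
    and smult: "\<And>c x. x \<in> carrier R \<Longrightarrow> f (c \<odot>\<^bsub>R\<^esub> x) = c \<odot>\<^bsub>S\<^esub> f x"
    and closed: "\<And>c x. x \<in> carrier R \<Longrightarrow> c \<odot>\<^bsub>R\<^esub> x \<in> carrier R"
    and I: "I \<subseteq> carrier R" and J: "f ` I = J"
    and F: "\<And>n. F n \<subseteq> carrier R" "\<And>n. f ` F n = F' n"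
  shows "alg_fam_iso (quot_alg R I) (\<lambda>n. (\<lambda>p. I +>\<^bsub>R\<^esub> p) ` F n)
    (quot_alg S J) (\<lambda>n. (\<lambda>p. J +>\<^bsub>S\<^esub> p) ` F' n)"
proof -
  interpret ring R by fact
  note hom = ring_iso_memE[OF f]
  have coset: "f ` (I +>\<^bsub>R\<^esub> x) = J +>\<^bsub>S\<^esub> f x" if "x \<in> carrier R" for x
    using image_a_r_coset[of I R x f S] I J hom that by auto
  have sub: "I +>\<^bsub>R\<^esub> x \<subseteq> carrier R" if "x \<in> carrier R" for x
    using I that unfolding a_r_coset_def r_coset_def by auto
  have add: "f ` (X <+>\<^bsub>R\<^esub> Y) = f ` X <+>\<^bsub>S\<^esub> f ` Y" if "X \<subseteq> carrier R" "Y \<subseteq> carrier R" for X Y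
    using that hom(3) unfolding set_add_def set_mult_def
    by (auto simp: subset_iff image_iff) (metis hom(3) that subsetD)+
  have bij: "bij_betw ((`) f) ((\<lambda>x. I +>\<^bsub>R\<^esub> x) ` carrier R) ((\<lambda>x. J +>\<^bsub>S\<^esub> x) ` carrier S)"
  proof (rule bij_betw_imageI)
    show "inj_on ((`) f) ((\<lambda>x. I +>\<^bsub>R\<^esub> x) ` carrier R)"
      by (rule inj_on_subset[OF inj_on_image_Pow[OF bij_betw_imp_inj_on[OF hom(5)]]])
        (use sub in auto)
    show "(`) f ` (\<lambda>x. I +>\<^bsub>R\<^esub> x) ` carrier R = (\<lambda>x. J +>\<^bsub>S\<^esub> x) ` carrier S"
      by (simp add: image_image coset flip: bij_betw_imp_surj_on[OF hom(5)] cong: image_cong_simp)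
  qed
  have mult: "f ` (rcoset_mult R I X Y) = rcoset_mult S J (f ` X) (f ` Y)"
    if "X \<subseteq> carrier R" "Y \<subseteq> carrier R" for X Y
    using that unfolding rcoset_mult_def image_UN
    by (simp add: coset hom(2) subset_iff cong: SUP_cong_simp)
  have "(`) f \<in> ring_iso (quot_alg R I) (quot_alg S J)"
  proof (rule ring_iso_memI; unfold quot_alg_simps)
    show "f ` (I +>\<^bsub>R\<^esub> \<one>\<^bsub>R\<^esub>) = J +>\<^bsub>S\<^esub> \<one>\<^bsub>S\<^esub>"
      by (simp add: coset hom(4))
    show "bij_betw ((`) f) ((\<lambda>x. I +>\<^bsub>R\<^esub> x) ` carrier R) ((\<lambda>x. J +>\<^bsub>S\<^esub> x) ` carrier S)"
      by (rule bij)
    show "f ` X \<in> (\<lambda>x. J +>\<^bsub>S\<^esub> x) ` carrier S" if "X \<in> (\<lambda>x. I +>\<^bsub>R\<^esub> x) ` carrier R" for X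
      using that coset hom(1) by auto
    fix X Y assume "X \<in> (\<lambda>x. I +>\<^bsub>R\<^esub> x) ` carrier R" "Y \<in> (\<lambda>x. I +>\<^bsub>R\<^esub> x) ` carrier R"
    then have XY: "X \<subseteq> carrier R" "Y \<subseteq> carrier R" using sub by auto
    show "f ` rcoset_mult R I X Y = rcoset_mult S J (f ` X) (f ` Y)" by (rule mult[OF XY])
    show "f ` (X <+>\<^bsub>R\<^esub> Y) = f ` X <+>\<^bsub>S\<^esub> f ` Y" by (rule add[OF XY])
  qed
  moreover have "f ` (I <+>\<^bsub>R\<^esub> (\<lambda>x. c \<odot>\<^bsub>R\<^esub> x) ` X) = J <+>\<^bsub>S\<^esub> (\<lambda>x. c \<odot>\<^bsub>S\<^esub> x) ` f ` X"
    if "X \<subseteq> carrier R" for c X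
    using that I closed
    by (subst add) (auto simp: J image_image smult subset_iff cong: image_cong_simp)
  moreover have "(`) f ` (\<lambda>p. I +>\<^bsub>R\<^esub> p) ` F n = (\<lambda>p. J +>\<^bsub>S\<^esub> p) ` F' n" for n
    by (simp add: image_image coset subsetD[OF F(1)] flip: F(2) cong: image_cong_simp)
  ultimately show ?thesis
    unfolding alg_fam_iso_def using sub by (intro bexI[of _ "(`) f"]) (auto simp: quot_alg_simps)
qed

subsection \<open>Quotients of the free algebra containing the group algebra\<close>

locale skew_setting =
  G: group G + V: finite_dimensional_vector_space scale B
  for G :: "('g, 'm) monoid_scheme" (structure)
    and scale :: "'k::field \<Rightarrow> 'v::ab_group_add \<Rightarrow> 'v" (infixr \<open>*s\<close> 75)
    and B :: "'v set" +
  fixes act :: "'g \<Rightarrow> 'v \<Rightarrow> 'v"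
  assumes fin_G: "finite (carrier G)"
    and action: "group_action G (UNIV :: 'v set) act"
    and act_linear: "g \<in> carrier G \<Longrightarrow> Vector_Spaces.linear scale scale (act g)"
begin

abbreviation A :: "(('v + 'g) fword \<Rightarrow>\<^sub>0 'k) set" where
  "A \<equiv> carrier (free_alg (gens G B))"

abbreviation vec :: "'v \<Rightarrow> (('v + 'g) fword \<Rightarrow>\<^sub>0 'k)" where
  "vec \<equiv> in_vec scale B"

abbreviation grp :: "'g \<Rightarrow> (('v + 'g) fword \<Rightarrow>\<^sub>0 'k)" where
  "grp \<equiv> in_grp"

text \<open>The image of the group algebra in the free algebra, parametrized by coefficient
  functions. Left and right multiplication by group elements then become translations of the
  argument.\<close>

definition gsum :: "('g \<Rightarrow> 'k) \<Rightarrow> (('v + 'g) fword \<Rightarrow>\<^sub>0 'k)" where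
  "gsum f = (\<Sum>g\<in>carrier G. pm_scale (f g) (grp g))"

lemma A_closed [simp, intro]:
  "p \<in> A \<Longrightarrow> q \<in> A \<Longrightarrow> p + q \<in> A" "p \<in> A \<Longrightarrow> q \<in> A \<Longrightarrow> p - q \<in> A"
  "p \<in> A \<Longrightarrow> q \<in> A \<Longrightarrow> p * q \<in> A" "p \<in> A \<Longrightarrow> - p \<in> A"
  "p \<in> A \<Longrightarrow> pm_scale c p \<in> A" "0 \<in> A" "1 \<in> A"
  by (auto intro: free_alg_closed free_alg_closed_0_1)

lemma A_sum [simp, intro]: "(\<And>i. i \<in> S \<Longrightarrow> f i \<in> A) \<Longrightarrow> (\<Sum>i\<in>S. f i) \<in> A"
  by (rule free_alg_sum_closed)

lemma grp_in_A [simp, intro]: "g \<in> carrier G \<Longrightarrow> grp g \<in> A"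
  by (auto simp: in_grp_def mem_free_alg gens_def)

lemma gsum_in_A [simp, intro]: "gsum f \<in> A"
  by (auto simp: gsum_def)

lemma vec_in_A [simp, intro]: "vec v \<in> A"
  unfolding in_vec_def by (rule A_sum) (auto simp: mem_free_alg gens_def split: if_splits)

lemma vec_add: "vec (v + w) = vec v + vec w"
  by (simp add: in_vec_def V.representation_add V.independent_Basis V.span_Basis single_add
      sum.distrib)

lemma vec_scale: "vec (c *s v) = pm_scale c (vec v)"
  by (simp add: in_vec_def V.representation_scale V.independent_Basis V.span_Basis
      pm.scale_sum_right)

lemma vec_linear: "Vector_Spaces.linear scale pm_scale vec"
  by (intro Vector_Spaces.linear_iff[THEN iffD2] conjI allI vec_add vec_scale
      V.vector_space_axioms vector_space_pm_scale)

lemma vec_diff: "vec (v - w) = vec v - vec w"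
  using vec_add[of "v - w" w] by simp

lemma vec_basis: "b \<in> B \<Longrightarrow> vec b = Poly_Mapping.single (FWord [Inl b]) 1"
  by (simp add: in_vec_def V.representation_basis V.independent_Basis if_distrib
      sum.delta V.finite_Basis cong: if_cong)

text \<open>Stated for an arbitrary linear \<open>t\<close>, since it serves both for
  \<open>vec\<close> itself and for the map \<gamma> into the group algebra.\<close>

lemma vec_expand: "Vector_Spaces.linear scale pm_scale t \<Longrightarrow>
    t v = (\<Sum>b\<in>B. pm_scale (V.representation B v b) (t b))"
proof -
  assume "Vector_Spaces.linear scale pm_scale t"
  then interpret t: Vector_Spaces.linear scale pm_scale t .
  have "t v = t (\<Sum>b\<in>B. V.representation B v b *s b)"
    by (subst V.sum_representation_eq) (auto simp: V.independent_Basis V.span_Basis V.finite_Basis)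
  then show ?thesis by (simp add: t.sum t.scale)
qed

lemma gsum_add: "gsum (\<lambda>a. f a + h a) = gsum f + gsum h"
  by (simp add: gsum_def pm.scale_left_distrib sum.distrib)

lemma gsum_diff: "gsum (\<lambda>a. f a - h a) = gsum f - gsum h"
  by (simp add: gsum_def pm.scale_left_diff_distrib sum_subtractf)

lemma gsum_scale: "gsum (\<lambda>a. c * f a) = pm_scale c (gsum f)"
  by (simp add: gsum_def pm.scale_sum_right)

lemma gsum_cong: "(\<And>a. a \<in> carrier G \<Longrightarrow> f a = h a) \<Longrightarrow> gsum f = gsum h"
  by (simp add: gsum_def)

lemma gsum_0 [simp]: "gsum (\<lambda>a. 0) = 0"
  by (simp add: gsum_def)

lemma gsum_sum: "gsum (\<lambda>a. \<Sum>i\<in>S. f i a) = (\<Sum>i\<in>S. gsum (f i))"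
  by (induction S rule: infinite_finite_induct) (simp_all add: gsum_add)

lemma in_kG_eq_gsum: "a \<in> kG G \<Longrightarrow> in_kG a = gsum (Poly_Mapping.lookup a)"
  unfolding in_kG_def gsum_def kG_def
  by (rule sum.mono_neutral_left) (auto simp: fin_G in_keys_iff)

lemma act_mult: "g \<in> carrier G \<Longrightarrow> h \<in> carrier G \<Longrightarrow> act (g \<otimes> h) v = act g (act h v)"
  using group_action.composition_rule[OF action] by simp

lemma act_one: "act \<one> v = v"
  using group_action.id_eq_one[OF action] by (metis UNIV_I restrict_apply')

lemma act_add: "g \<in> carrier G \<Longrightarrow> act g (v + w) = act g v + act g w"
  using act_linear[of g] by (simp add: Vector_Spaces.linear_iff)

lemma act_scale: "g \<in> carrier G \<Longrightarrow> act g (c *s v) = c *s act g v"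
  using act_linear[of g] by (simp add: Vector_Spaces.linear_iff)

end

section \<open>Congruences modulo an ideal that contains the relations of \<open>G\<close>\<close>

locale skew_quotient = skew_setting G scale B act
  for G :: "('g, 'm) monoid_scheme" (structure)
    and scale :: "'k::field \<Rightarrow> 'v::ab_group_add \<Rightarrow> 'v" (infixr \<open>*s\<close> 75)
    and B :: "'v set" and act :: "'g \<Rightarrow> 'v \<Rightarrow> 'v" +
  fixes I :: "(('v + 'g) fword \<Rightarrow>\<^sub>0 'k) set"
  assumes ideal_I: "ideal I (free_alg (gens G B))"
    and grp_one: "grp \<one> - 1 \<in> I"
    and grp_mult: "g \<in> carrier G \<Longrightarrow> h \<in> carrier G \<Longrightarrow> grp g * grp h - grp (g \<otimes> h) \<in> I"
begin

lemma I_0 [simp]: "0 \<in> I"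
  using additive_subgroup.zero_closed[OF ideal.axioms(1)[OF ideal_I]] by simp

lemma I_add: "p \<in> I \<Longrightarrow> q \<in> I \<Longrightarrow> p + q \<in> I"
  using additive_subgroup.a_closed[OF ideal.axioms(1)[OF ideal_I]] by simp

lemma I_in_A: "p \<in> I \<Longrightarrow> p \<in> A"
  using additive_subgroup.a_subset[OF ideal.axioms(1)[OF ideal_I]] by auto

lemma I_mult_left: "p \<in> A \<Longrightarrow> q \<in> I \<Longrightarrow> p * q \<in> I"
  using ideal.I_l_closed[OF ideal_I] by simp

lemma I_mult_right: "p \<in> I \<Longrightarrow> q \<in> A \<Longrightarrow> p * q \<in> I"
  using ideal.I_r_closed[OF ideal_I] by simp

text \<open>Scaling is multiplication by the constant \<open>pm_scale c 1\<close>, so a ring ideal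
  is automatically a subspace.\<close>

lemma I_scale: "p \<in> I \<Longrightarrow> pm_scale c p \<in> I"
  using I_mult_left[of "pm_scale c 1" p] by (simp add: pm_scale_mult_left)

lemma I_uminus: "p \<in> I \<Longrightarrow> - p \<in> I"
  using I_scale[of p "- 1"] by simp

definition eqv (infix \<open>\<approx>\<close> 50) where "p \<approx> q \<longleftrightarrow> p - q \<in> I"

lemma eqv_refl [simp]: "p \<approx> p"
  by (simp add: eqv_def)

lemma eqv_sym: "p \<approx> q \<Longrightarrow> q \<approx> p"
  using I_uminus[of "p - q"] by (simp add: eqv_def)

lemma eqv_trans [trans]: "p \<approx> q \<Longrightarrow> q \<approx> r \<Longrightarrow> p \<approx> r"
  using I_add[of "p - q" "q - r"] by (simp add: eqv_def)

lemma eqv_add: "p \<approx> p' \<Longrightarrow> q \<approx> q' \<Longrightarrow> p + q \<approx> p' + q'"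
  using I_add[of "p - p'" "q - q'"] by (simp add: eqv_def algebra_simps)

lemma eqv_uminus: "p \<approx> p' \<Longrightarrow> - p \<approx> - p'"
  using I_uminus[of "p - p'"] by (simp add: eqv_def)

lemma eqv_diff: "p \<approx> p' \<Longrightarrow> q \<approx> q' \<Longrightarrow> p - q \<approx> p' - q'"
  using eqv_add[OF _ eqv_uminus] by simp

lemma eqv_scale: "p \<approx> p' \<Longrightarrow> pm_scale c p \<approx> pm_scale c p'"
  using I_scale[of "p - p'" c] by (simp add: eqv_def pm.scale_right_diff_distrib)

lemma eqv_sum: "(\<And>i. i \<in> S \<Longrightarrow> f i \<approx> h i) \<Longrightarrow> (\<Sum>i\<in>S. f i) \<approx> (\<Sum>i\<in>S. h i)"
  by (induction S rule: infinite_finite_induct) (auto intro: eqv_add)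

lemma eqv_mult_left: "p \<approx> p' \<Longrightarrow> r \<in> A \<Longrightarrow> r * p \<approx> r * p'"
  using I_mult_left[of r "p - p'"] by (simp add: eqv_def right_diff_distrib)

lemma eqv_mult_right: "p \<approx> p' \<Longrightarrow> r \<in> A \<Longrightarrow> p * r \<approx> p' * r"
  using I_mult_right[of "p - p'" r] by (simp add: eqv_def left_diff_distrib)

lemma grp_mult_eqv: "g \<in> carrier G \<Longrightarrow> h \<in> carrier G \<Longrightarrow> grp g * grp h \<approx> grp (g \<otimes> h)"
  using grp_mult by (simp add: eqv_def)

lemma grp_one_eqv: "grp \<one> \<approx> 1"
  using grp_one by (simp add: eqv_def)

text \<open>Multiply out and reindex by \<open>h \<mapsto> g \<otimes> h\<close>; the coefficient at
  \<open>a\<close> then comes from \<open>inv g \<otimes> a\<close>.\<close>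

lemma grp_gsum: 
  assumes g: "g \<in> carrier G"
  shows "grp g * gsum f \<approx> gsum (\<lambda>a. f (inv g \<otimes> a))"
proof -
  have "grp g * gsum f = (\<Sum>h\<in>carrier G. pm_scale (f h) (grp g * grp h))"
    by (simp add: gsum_def sum_distrib_left pm_scale_mult_right)
  also have "\<dots> \<approx> (\<Sum>h\<in>carrier G. pm_scale (f h) (grp (g \<otimes> h)))"
    using g by (intro eqv_sum eqv_scale grp_mult_eqv)
  also have "\<dots> = gsum (\<lambda>a. f (inv g \<otimes> a))"
    unfolding gsum_def using g
    by (intro sum.reindex_bij_witness[of _ "\<lambda>a. inv g \<otimes> a" "\<lambda>h. g \<otimes> h"])
      (auto simp: G.m_assoc[symmetric])
  finally show ?thesis .
qed

lemma gsum_grp: 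
  assumes g: "g \<in> carrier G"
  shows "gsum f * grp g \<approx> gsum (\<lambda>a. f (a \<otimes> inv g))"
proof -
  have "gsum f * grp g = (\<Sum>h\<in>carrier G. pm_scale (f h) (grp h * grp g))"
    by (simp add: gsum_def sum_distrib_right pm_scale_mult_left)
  also have "\<dots> \<approx> (\<Sum>h\<in>carrier G. pm_scale (f h) (grp (h \<otimes> g)))"
    using g by (intro eqv_sum eqv_scale grp_mult_eqv)
  also have "\<dots> = gsum (\<lambda>a. f (a \<otimes> inv g))"
    unfolding gsum_def using g
    by (intro sum.reindex_bij_witness[of _ "\<lambda>a. a \<otimes> inv g" "\<lambda>h. h \<otimes> g"])
      (auto simp: G.m_assoc)
  finally show ?thesis .
qed

lemma gsum_commutator_symmetric:
  fixes c :: "'v \<Rightarrow> 'g \<Rightarrow> 'k"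
  assumes t: "Vector_Spaces.linear scale pm_scale t" "\<And>v. t v \<in> A"
    and equi: "\<And>g v. g \<in> carrier G \<Longrightarrow> grp g * t v \<approx> t (act g v) * grp g"
    and c: "\<And>a v w. a \<in> carrier G \<Longrightarrow> c v a *s (act a w - w) = c w a *s (act a v - v)"
  shows "gsum (c v) * t w - t w * gsum (c v) \<approx> gsum (c w) * t v - t v * gsum (c w)"
proof -
  interpret t: Vector_Spaces.linear scale pm_scale t by fact
  have *: "gsum (c v) * t w - t w * gsum (c v)
      \<approx> (\<Sum>a\<in>carrier G. t (c v a *s (act a w - w)) * grp a)" for v w
  proof -
    have "gsum (c v) * t w - t w * gsum (c v)
        = (\<Sum>a\<in>carrier G. pm_scale (c v a) (grp a * t w - t w * grp a))"
      by (simp add: gsum_def sum_distrib_left sum_distrib_right pm_scale_mult_left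
          pm_scale_mult_right sum_subtractf pm.scale_right_diff_distrib)
    also have "\<dots> \<approx> (\<Sum>a\<in>carrier G. pm_scale (c v a) (t (act a w) * grp a - t w * grp a))"
      by (intro eqv_sum eqv_scale eqv_diff equi eqv_refl)
    also have "\<dots> = (\<Sum>a\<in>carrier G. t (c v a *s (act a w - w)) * grp a)"
      by (simp add: t.scale t.diff pm_scale_mult_left left_diff_distrib)
    finally show ?thesis .
  qed
  have "(\<Sum>a\<in>carrier G. t (c v a *s (act a w - w)) * grp a)
      = (\<Sum>a\<in>carrier G. t (c w a *s (act a v - v)) * grp a)"
    by (intro sum.cong refl) (simp add: c)
  then show ?thesis
    using eqv_trans[OF *[of v w] eqv_sym] *[of w v] by simp
qed

text \<open>After expanding, the mixed terms form the difference of the two sides of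
  \<open>gsum_commutator_symmetric\<close> and hence vanish modulo \<open>I\<close>.\<close>

lemma shifted_commutator:
  fixes c :: "'v \<Rightarrow> 'g \<Rightarrow> 'k"
  assumes t: "Vector_Spaces.linear scale pm_scale t" "\<And>v. t v \<in> A"
    and equi: "\<And>g v. g \<in> carrier G \<Longrightarrow> grp g * t v \<approx> t (act g v) * grp g"
    and c: "\<And>a v w. a \<in> carrier G \<Longrightarrow> c v a *s (act a w - w) = c w a *s (act a v - v)"
  shows "(t v - gsum (c v)) * (t w - gsum (c w)) - (t w - gsum (c w)) * (t v - gsum (c v))
    \<approx> (t v * t w - t w * t v) + (gsum (c v) * gsum (c w) - gsum (c w) * gsum (c v))"
  using gsum_commutator_symmetric[OF assms, of w v]
  by (simp add: eqv_def algebra_simps)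

end

text \<open>Since the ideal generated by a set is the smallest one containing it, this preimage
  reduces statements about all of a relation ideal to its relators.\<close>

lemma ideal_vimage_subst:
  fixes s :: "'x \<Rightarrow> ('y fword \<Rightarrow>\<^sub>0 'k::field)"
  assumes J: "ideal J (free_alg Y)" and s: "\<And>x. x \<in> X \<Longrightarrow> s x \<in> carrier (free_alg Y)"
  shows "ideal {p \<in> carrier (free_alg X). subst s p \<in> J} (free_alg X)"
proof -
  interpret J: ideal J "free_alg Y :: ('k, _) module" by (rule J)
  have J_0: "0 \<in> J" and J_add: "\<And>p q. p \<in> J \<Longrightarrow> q \<in> J \<Longrightarrow> p + q \<in> J"
    and J_left: "\<And>p q. q \<in> carrier (free_alg Y) \<Longrightarrow> p \<in> J \<Longrightarrow> q * p \<in> J"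
    and J_right: "\<And>p q. q \<in> carrier (free_alg Y) \<Longrightarrow> p \<in> J \<Longrightarrow> p * q \<in> J"
    using additive_subgroup.zero_closed[OF ideal.axioms(1)[OF J]]
      additive_subgroup.a_closed[OF ideal.axioms(1)[OF J]] J.I_l_closed J.I_r_closed by auto
  have J_uminus: "- p \<in> J" if "p \<in> J" for p
    using J_left[of "- 1" p] that by (auto intro: free_alg_closed free_alg_closed_0_1)
  show ?thesis
  proof (rule idealI)
    show "subgroup {p \<in> carrier (free_alg X). subst s p \<in> J} (add_monoid (free_alg X))"
    proof
      fix p assume p: "p \<in> {p \<in> carrier (free_alg X). subst s p \<in> J}"
      interpret R: ring "free_alg X :: ('k, _) module" by (rule ring_free_alg)
      have "inv\<^bsub>add_monoid (free_alg X)\<^esub> p = - p"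
        using R.minus_equality[of "- p" p] p by (auto simp: a_inv_def intro: free_alg_closed)
      then show "inv\<^bsub>add_monoid (free_alg X)\<^esub> p \<in> {p \<in> carrier (free_alg X). subst s p \<in> J}"
        using p by (auto simp: subst_uminus J_uminus intro: free_alg_closed)
    qed (auto simp: subst_add J_0 J_add intro: free_alg_closed free_alg_closed_0_1)
  qed (auto simp: subst_mult ring_free_alg intro: free_alg_closed J_left J_right subst_closed s)
qed

section \<open>Relation ideals, the shift of generators by \<gamma>, and the commutator
  parameter\<close>

context skew_setting
begin

lemma in_kG_in_A: "a \<in> kG G \<Longrightarrow> in_kG a \<in> A"
  by (simp add: in_kG_eq_gsum)

lemma relators_in_A:
  assumes "\<And>g v. g \<in> carrier G \<Longrightarrow> lam (Poly_Mapping.single g 1) v \<in> kG G" "\<And>v w. kap v w \<in> kG G"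
  shows "relators G scale B act lam kap \<subseteq> A"
  using assms unfolding relators_def by (auto intro!: A_closed in_kG_in_A)

lemma relator_grp_vec: "g \<in> carrier G \<Longrightarrow> grp g * vec v - vec (act g v) * grp g
    - in_kG (lam (Poly_Mapping.single g 1) v) \<in> relators G scale B act lam kap"
  unfolding relators_def by blast

lemma relator_vec_vec: "vec v * vec w - vec w * vec v - in_kG (kap v w)
    \<in> relators G scale B act lam kap"
  unfolding relators_def by blast

text \<open>Parameters with values in the group algebra are all that is assumed here, so the
  congruence calculus becomes available for both algebras to be compared.\<close>

lemma skew_quotient_rel_ideal:
  assumes "\<And>g v. g \<in> carrier G \<Longrightarrow> lam (Poly_Mapping.single g 1) v \<in> kG G" "\<And>v w. kap v w \<in> kG G"
  shows "skew_quotient G scale B act (rel_ideal G scale B act lam kap)"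
    and "relators G scale B act lam kap \<subseteq> rel_ideal G scale B act lam kap"
proof -
  interpret R: ring "free_alg (gens G B) :: ('k, ('v + 'g) fword \<Rightarrow>\<^sub>0 'k) module"
    by (rule ring_free_alg)
  show *: "relators G scale B act lam kap \<subseteq> rel_ideal G scale B act lam kap"
    unfolding rel_ideal_def by (rule R.genideal_self) (intro relators_in_A assms)
  show "skew_quotient G scale B act (rel_ideal G scale B act lam kap)"
  proof (intro skew_quotient.intro skew_setting_axioms skew_quotient_axioms.intro)
    show "ideal (rel_ideal G scale B act lam kap) (free_alg (gens G B))"
      unfolding rel_ideal_def by (rule R.genideal_ideal) (intro relators_in_A assms)
  qed (use * in \<open>auto simp: relators_def\<close>)
qed

lemma subst_rel_ideal:
  assumes "skew_quotient G scale B act J" and s: "\<And>x. x \<in> gens G B \<Longrightarrow> s x \<in> A"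
    and "relators G scale B act lam kap \<subseteq> A"
    and "subst s ` relators G scale B act lam kap \<subseteq> J"
  shows "subst s ` rel_ideal G scale B act lam kap \<subseteq> J"
proof -
  interpret R: ring "free_alg (gens G B) :: ('k, ('v + 'g) fword \<Rightarrow>\<^sub>0 'k) module"
    by (rule ring_free_alg)
  interpret J: skew_quotient G scale B act J by fact
  have "rel_ideal G scale B act lam kap \<subseteq> {p \<in> A. subst s p \<in> J}"
    unfolding rel_ideal_def
    by (rule R.genideal_minimal[OF ideal_vimage_subst[OF J.ideal_I s]]) (use assms in auto)
  then show ?thesis by auto
qed

text \<open>The substitution \<open>v \<mapsto> v + \<gamma>(v)\<close>,
  \<open>g \<mapsto> g\<close> on generators, where \<open>c v a\<close> is the coefficient of
  \<gamma>(v) at \<open>a\<close>.\<close>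

definition shift :: "('v \<Rightarrow> 'g \<Rightarrow> 'k) \<Rightarrow> 'v + 'g \<Rightarrow> (('v + 'g) fword \<Rightarrow>\<^sub>0 'k)" where
  "shift c x = (case x of
     Inl b \<Rightarrow> Poly_Mapping.single (FWord [Inl b]) 1 + gsum (c b) | Inr g \<Rightarrow> grp g)"

lemma subst_grp: "subst (shift c) (grp g) = grp g"
  by (simp add: in_grp_def[of g] subst_single) (simp add: shift_def in_grp_def)

lemma subst_gsum: "subst (shift c) (gsum f) = gsum f"
  by (simp add: gsum_def subst_sum subst_scale subst_grp)

lemma subst_in_kG: "a \<in> kG G \<Longrightarrow> subst (shift c) (in_kG a) = in_kG a"
  by (simp add: in_kG_eq_gsum subst_gsum)

text \<open>The shift is prescribed on basis vectors only; linearity of \<gamma> gives the same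
  formula for every vector.\<close>

lemma subst_vec:
  assumes "Vector_Spaces.linear scale pm_scale (\<lambda>v. gsum (c v))"
  shows "subst (shift c) (vec v) = vec v + gsum (c v)"
proof -
  have "subst (shift c) (vec v) = (\<Sum>b\<in>B. pm_scale (V.representation B v b)
      (Poly_Mapping.single (FWord [Inl b]) 1 + gsum (c b)))"
    unfolding in_vec_def by (simp add: subst_sum subst_single shift_def)
  also have "\<dots> = vec v + gsum (c v)"
    using vec_expand[OF assms, of v]
    by (simp add: pm.scale_right_distrib sum.distrib in_vec_def)
  finally show ?thesis .
qed

text \<open>The values of \<gamma> lie in the group algebra, which every shift fixes, so the shifts
  by \<gamma> and by its negative undo each other on the letters and therefore everywhere.\<close>

lemma subst_shift_inverse: "subst (shift (\<lambda>v a. - c v a)) (subst (shift c) p) = p"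
proof -
  have "subst (shift (\<lambda>v a. - c v a)) (shift c x) = Poly_Mapping.single (FWord [x]) 1" for x
    using gsum_diff[of "\<lambda>a. 0"]
    by (cases x) (simp_all add: shift_def subst_add subst_gsum subst_single subst_grp in_grp_def
        flip: in_grp_def)
  then show ?thesis
    by (simp add: subst_subst subst_letters)
qed

lemma shift_in_A:
  assumes "x \<in> gens G B"
  shows "shift c x \<in> A"
proof (cases x)
  case (Inl b)
  then have "shift c x = vec b + gsum (c b)"
    using assms by (auto simp: shift_def vec_basis gens_def)
  then show ?thesis by simp
next
  case (Inr g)
  then have "g \<in> carrier G" using assms by (auto simp: gens_def)
  then show ?thesis by (simp add: shift_def Inr)
qed

text \<open>The added element of the group algebra has degree zero, so a shift respects the
  filtration.\<close>

lemma shift_deg_le: "shift c x \<in> deg_le (if isl x then 1 else 0)"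
proof -
  have "grp g \<in> deg_le n" for g n
    by (auto simp: in_grp_def deg_le_def vdeg_def)
  then have "gsum f \<in> deg_le n" for f n
    by (auto simp: gsum_def intro!: deg_le_sum deg_le_closed(3))
  moreover have "Poly_Mapping.single (FWord [Inl b]) 1 \<in> deg_le 1" for b :: 'v
    by (auto simp: deg_le_def vdeg_def)
  ultimately show ?thesis
    using \<open>\<And>g n. grp g \<in> deg_le n\<close> by (auto simp: shift_def split: sum.split intro: deg_le_closed(1))
qed

text \<open>This is \<open>\<gamma>(w) \<gamma>(v) - \<gamma>(v) \<gamma>(w)\<close>, multiplied out
  with the product of \<open>G\<close> because a parameter takes formal combinations of group
  elements as values.\<close>

definition commutator_param :: "('v \<Rightarrow> 'g \<Rightarrow> 'k) \<Rightarrow> 'v \<Rightarrow> 'v \<Rightarrow> ('g \<Rightarrow>\<^sub>0 'k)" where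
  "commutator_param c v w = (\<Sum>a\<in>carrier G. \<Sum>b\<in>carrier G.
     Poly_Mapping.single (a \<otimes> b) (c w a * c v b - c v a * c w b))"

lemma kG_sum: "(\<And>i. i \<in> S \<Longrightarrow> f i \<in> kG G) \<Longrightarrow> (\<Sum>i\<in>S. f i) \<in> kG G"
proof (induction S rule: infinite_finite_induct)
  case (insert i S)
  then show ?case
    using keys_add[of "f i" "\<Sum>i\<in>S. f i"] by (auto simp: kG_def)
qed (auto simp: kG_def)

lemma commutator_param_in_kG: "commutator_param c v w \<in> kG G"
  unfolding commutator_param_def
  by (intro kG_sum) (simp add: kG_def)

text \<open>Each coefficient is bilinear in the values of \<open>c\<close> and vanishes identically
  for equal arguments, so the form is alternating in characteristic 2 as well.\<close>

lemma kappa_param_commutator: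
  assumes add: "\<And>v w a. a \<in> carrier G \<Longrightarrow> c (v + w) a = c v a + c w a"
    and scale: "\<And>r v a. a \<in> carrier G \<Longrightarrow> c (r *s v) a = r * c v a"
  shows "kappa_param G scale (commutator_param c)"
proof -
  have "commutator_param c (v + w) u = commutator_param c v u + commutator_param c w u"
    "commutator_param c u (v + w) = commutator_param c u v + commutator_param c u w"
    "commutator_param c (r *s v) w = pm_scale r (commutator_param c v w)"
    "commutator_param c v (r *s w) = pm_scale r (commutator_param c v w)" for r u v w
    unfolding commutator_param_def pm.scale_sum_right
    by (auto simp: add scale algebra_simps simp flip: sum.distrib single_add intro!: sum.cong)
  moreover have "commutator_param c v v = 0" for v
    by (simp add: commutator_param_def)
  ultimately show ?thesis
    using V.vector_space_axioms vector_space_pm_scale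
    by (auto simp: kappa_param_def Vector_Spaces.linear_iff commutator_param_in_kG)
qed

end

context skew_quotient
begin

text \<open>An equality only modulo \<open>I\<close>: the left side uses letters for products
  \<open>a \<otimes> b\<close>, the right side words of two letters.\<close>

lemma in_kG_commutator_param:
  "in_kG (commutator_param c v w) \<approx> gsum (c w) * gsum (c v) - gsum (c v) * gsum (c w)"
proof -
  have single: "gsum (Poly_Mapping.lookup (Poly_Mapping.single g r)) = pm_scale r (grp g)"
    if "g \<in> carrier G" for g r
    using that unfolding gsum_def
    by (subst sum.remove[of _ g]) (auto simp: fin_G lookup_single when_def intro!: sum.neutral split: if_splits)
  have prod: "gsum (c v) * gsum (c w)
      = (\<Sum>a\<in>carrier G. \<Sum>b\<in>carrier G. pm_scale (c v a * c w b) (grp a * grp b))" for v w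
    unfolding gsum_def sum_product
    by (simp add: pm_scale_mult_left pm_scale_mult_right mult.commute)
  have lookup_sum_fun: "Poly_Mapping.lookup (\<Sum>i\<in>S. f i) = (\<lambda>a. \<Sum>i\<in>S. Poly_Mapping.lookup (f i) a)"
    for f :: "'g \<Rightarrow> 'g \<Rightarrow>\<^sub>0 'k" and S
    by (rule ext) (rule lookup_sum)
  have "in_kG (commutator_param c v w) = (\<Sum>a\<in>carrier G. \<Sum>b\<in>carrier G.
      pm_scale (c w a * c v b - c v a * c w b) (grp (a \<otimes> b)))"
    by (simp add: in_kG_eq_gsum[OF commutator_param_in_kG])
      (simp add: commutator_param_def lookup_sum_fun gsum_sum single cong: sum.cong)
  also have "\<dots> \<approx> (\<Sum>a\<in>carrier G. \<Sum>b\<in>carrier G.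
      pm_scale (c w a * c v b - c v a * c w b) (grp a * grp b))"
    by (intro eqv_sum eqv_scale eqv_sym[OF grp_mult_eqv])
  also have "\<dots> = gsum (c w) * gsum (c v) - gsum (c v) * gsum (c w)"
    by (simp add: prod sum_subtractf pm.scale_left_diff_distrib)
  finally show ?thesis .
qed

end

section \<open>The filtered isomorphism obtained from suitable coefficients of \<gamma>\<close>

context skew_setting
begin

lemma H_filt_eq:
  "H_filt G scale B act lam kap = (\<lambda>n. (\<lambda>p. rel_ideal G scale B act lam kap
    +>\<^bsub>free_alg (gens G B)\<^esub> p) ` (A \<inter> deg_le n))"
  by (rule ext) (auto simp: H_filt_def deg_le_def)

text \<open>Hypothesis \<open>c_act\<close> says in coefficients that
  \<open>\<lambda>(g, v) = \<gamma>(g v) g - g \<gamma>(v)\<close>, and \<open>c_sym\<close> is what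
  cancels the mixed commutators. Under both, the shifts by \<gamma> and by its negative exchange the
  two relation ideals.\<close>

lemma commutator_param_iso:
  assumes lam: "\<And>g v. g \<in> carrier G \<Longrightarrow> lam (Poly_Mapping.single g 1) v \<in> kG G"
    and c_add: "\<And>v w a. a \<in> carrier G \<Longrightarrow> c (v + w) a = c v a + c w a"
    and c_scale: "\<And>r v a. a \<in> carrier G \<Longrightarrow> c (r *s v) a = r * c v a"
    and c_act: "\<And>g v a. g \<in> carrier G \<Longrightarrow> a \<in> carrier G \<Longrightarrow>
      Poly_Mapping.lookup (lam (Poly_Mapping.single g 1) v) a
        = c (act g v) (a \<otimes> inv g) - c v (inv g \<otimes> a)"
    and c_sym: "\<And>a v w. a \<in> carrier G \<Longrightarrow> c v a *s (act a w - w) = c w a *s (act a v - v)"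
  shows "alg_fam_iso
    (H_alg G scale B act (\<lambda>_ _. 0) (commutator_param c))
    (H_filt G scale B act (\<lambda>_ _. 0) (commutator_param c))
    (H_alg G scale B act lam (\<lambda>_ _. 0)) (H_filt G scale B act lam (\<lambda>_ _. 0))"
proof -
  let ?c' = "\<lambda>v a. - c v a"
  let ?kap = "commutator_param c"
  define Ik where "Ik = rel_ideal G scale B act (\<lambda>_ _. 0) ?kap"
  define Il where "Il = rel_ideal G scale B act lam (\<lambda>_ _. 0)"
  have kG_0: "0 \<in> kG G" by (simp add: kG_def)
  have in_kG_0: "in_kG 0 = 0" by (simp add: in_kG_def)
  note hyps = kG_0 commutator_param_in_kG lam
  interpret k: skew_quotient G scale B act Ik
    unfolding Ik_def by (rule skew_quotient_rel_ideal) (simp_all add: hyps)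
  interpret l: skew_quotient G scale B act Il
    unfolding Il_def by (rule skew_quotient_rel_ideal) (simp_all add: hyps)
  have rel_k: "relators G scale B act (\<lambda>_ _. 0) ?kap \<subseteq> Ik"
    unfolding Ik_def by (rule skew_quotient_rel_ideal) (simp_all add: hyps)
  have rel_l: "relators G scale B act lam (\<lambda>_ _. 0) \<subseteq> Il"
    unfolding Il_def by (rule skew_quotient_rel_ideal) (simp_all add: hyps)
  have lin: "Vector_Spaces.linear scale pm_scale (\<lambda>v. gsum (c v))"
  proof -
    have "gsum (c (v + w)) = gsum (c v) + gsum (c w)" for v w
      unfolding gsum_add[symmetric] by (intro gsum_cong c_add)
    moreover have "gsum (c (r *s v)) = pm_scale r (gsum (c v))" for r v
      unfolding gsum_scale[symmetric] by (intro gsum_cong c_scale)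
    ultimately show ?thesis
      by (simp add: Vector_Spaces.linear_iff V.vector_space_axioms vector_space_pm_scale)
  qed
  have gsum_c': "gsum (?c' v) = - gsum (c v)" for v
    using gsum_diff[of "\<lambda>a. 0" "c v"] by simp
  have lin': "Vector_Spaces.linear scale pm_scale (\<lambda>v. gsum (?c' v))"
    using lin by (simp add: gsum_c' Vector_Spaces.linear_iff)
  have lin_t: "Vector_Spaces.linear scale pm_scale (\<lambda>v. vec v + gsum (c v))"
    using lin vec_linear by (simp add: Vector_Spaces.linear_iff pm.scale_right_distrib)

  have lam_gsum: "in_kG (lam (Poly_Mapping.single g 1) v)
      = gsum (\<lambda>a. c (act g v) (a \<otimes> inv g)) - gsum (\<lambda>a. c v (inv g \<otimes> a))"
    if "g \<in> carrier G" for g v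
    unfolding in_kG_eq_gsum[OF lam[OF that]] gsum_diff[symmetric]
    by (intro gsum_cong c_act that)

  have l_vec: "l.eqv (grp g * vec v)
      (vec (act g v) * grp g + in_kG (lam (Poly_Mapping.single g 1) v))" if "g \<in> carrier G" for g v
    using subsetD[OF rel_l relator_grp_vec[OF that]] by (simp add: l.eqv_def diff_diff_eq)
  have l_comm: "l.eqv (vec v * vec w) (vec w * vec v)" for v w
    using subsetD[OF rel_l relator_vec_vec] by (simp add: l.eqv_def in_kG_0)
  have k_vec: "k.eqv (grp g * vec v) (vec (act g v) * grp g)" if "g \<in> carrier G" for g v
    using subsetD[OF rel_k relator_grp_vec[OF that]] by (simp add: k.eqv_def in_kG_0)
  have k_comm: "k.eqv (vec v * vec w - vec w * vec v) (in_kG (?kap v w))" for v w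
    using subsetD[OF rel_k relator_vec_vec] by (simp add: k.eqv_def)

  \<comment> \<open>The term \<lambda>(g, v) produced by moving \<open>g\<close> past
    \<open>v\<close> is exactly what turns \<open>g \<gamma>(v)\<close> into
    \<open>\<gamma>(g v) g\<close>.\<close>
  have l_equi: "l.eqv (grp g * (vec v + gsum (c v))) ((vec (act g v) + gsum (c (act g v))) * grp g)"
    if g: "g \<in> carrier G" for g v
  proof -
    have "l.eqv (grp g * vec v + grp g * gsum (c v))
        ((vec (act g v) * grp g + in_kG (lam (Poly_Mapping.single g 1) v))
          + gsum (\<lambda>a. c v (inv g \<otimes> a)))"
      by (intro l.eqv_add l_vec l.grp_gsum g)
    also have "\<dots> = vec (act g v) * grp g + gsum (\<lambda>a. c (act g v) (a \<otimes> inv g))"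
      by (simp add: lam_gsum g)
    also have "l.eqv \<dots> (vec (act g v) * grp g + gsum (c (act g v)) * grp g)"
      by (intro l.eqv_add l.eqv_refl l.eqv_sym[OF l.gsum_grp] g)
    finally show ?thesis by (simp add: algebra_simps)
  qed

  have "subst (shift c) ` Ik \<subseteq> Il"
    unfolding Ik_def
  proof (rule subst_rel_ideal[OF l.skew_quotient_axioms shift_in_A])
    show "relators G scale B act (\<lambda>_ _. 0) ?kap \<subseteq> A"
      using rel_k k.I_in_A by blast
    have "(vec v + gsum (c v)) * (vec w + gsum (c w)) - (vec w + gsum (c w)) * (vec v + gsum (c v))
        - in_kG (?kap v w) \<in> Il" for v w
    proof -
      \<comment> \<open>Here \<open>t v\<close> is \<open>v + \<gamma>(v)\<close>, so that
        \<open>t v - \<gamma>(v)\<close> is the original generator, and the original generators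
        commute modulo \<open>Il\<close>.\<close>
      have "l.eqv (vec v * vec w - vec w * vec v)
          (((vec v + gsum (c v)) * (vec w + gsum (c w)) - (vec w + gsum (c w)) * (vec v + gsum (c v)))
            + (gsum (c v) * gsum (c w) - gsum (c w) * gsum (c v)))"
        using l.shifted_commutator[OF lin_t _ l_equi c_sym, of v w] by simp
      from l.I_add[OF l.I_uminus[OF this[unfolded l.eqv_def]]
          l.eqv_diff[OF l_comm[of v w] l.in_kG_commutator_param[of c v w], unfolded l.eqv_def]]
      show ?thesis
        by (simp add: algebra_simps)
    qed
    then show "subst (shift c) ` relators G scale B act (\<lambda>_ _. 0) ?kap \<subseteq> Il"
      using l.grp_one l.grp_mult l_equi
      by (auto simp: relators_def subst_diff subst_mult subst_grp subst_vec[OF lin] in_kG_0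
          subst_in_kG[OF commutator_param_in_kG] l.eqv_def)
  qed
  moreover have "subst (shift ?c') ` Il \<subseteq> Ik"
    unfolding Il_def
  proof (rule subst_rel_ideal[OF k.skew_quotient_axioms shift_in_A])
    show "relators G scale B act lam (\<lambda>_ _. 0) \<subseteq> A"
      using rel_l l.I_in_A by blast
    have "(vec v - gsum (c v)) * (vec w - gsum (c w)) - (vec w - gsum (c w)) * (vec v - gsum (c v))
        \<in> Ik" for v w
    proof -
      \<comment> \<open>Now \<open>t\<close> is \<open>vec\<close> itself, which is already
        equivariant modulo \<open>Ik\<close>; the commutator of the generators is the parameter,
        which cancels that of the values of \<gamma>.\<close>
      have "k.eqv ((vec v - gsum (c v)) * (vec w - gsum (c w))
            - (vec w - gsum (c w)) * (vec v - gsum (c v)))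
          ((vec v * vec w - vec w * vec v) + (gsum (c v) * gsum (c w) - gsum (c w) * gsum (c v)))"
        by (rule k.shifted_commutator[OF vec_linear _ k_vec c_sym]) auto
      also have "k.eqv \<dots> ((gsum (c w) * gsum (c v) - gsum (c v) * gsum (c w))
          + (gsum (c v) * gsum (c w) - gsum (c w) * gsum (c v)))"
        by (intro k.eqv_add k.eqv_refl k.eqv_trans[OF k_comm k.in_kG_commutator_param])
      finally show ?thesis by (simp add: k.eqv_def)
    qed
    moreover have "grp g * (vec v - gsum (c v)) - (vec (act g v) - gsum (c (act g v))) * grp g
        - in_kG (lam (Poly_Mapping.single g 1) v) \<in> Ik" if g: "g \<in> carrier G" for g v
    proof -
      have "k.eqv (grp g * vec v - grp g * gsum (c v) + gsum (c (act g v)) * grp g)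
          (vec (act g v) * grp g - gsum (\<lambda>a. c v (inv g \<otimes> a))
            + gsum (\<lambda>a. c (act g v) (a \<otimes> inv g)))"
        by (intro k.eqv_add k.eqv_diff k_vec k.grp_gsum k.gsum_grp g)
      then show ?thesis by (simp add: k.eqv_def lam_gsum[OF g] algebra_simps)
    qed
    ultimately show "subst (shift ?c') ` relators G scale B act lam (\<lambda>_ _. 0) \<subseteq> Ik"
      using k.grp_one k.grp_mult
      by (auto simp: relators_def subst_diff subst_mult subst_grp subst_vec[OF lin'] in_kG_0
          gsum_c' subst_in_kG[OF lam])
  qed
  moreover have inverse: "subst (shift c) (subst (shift ?c') p) = p" for p
    using subst_shift_inverse[of ?c' p] by simp
  \<comment> \<open>Mutually inverse maps carry each ideal into the other, so the first inclusion is
    an equality.\<close>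
  ultimately have image: "subst (shift c) ` Ik = Il"
    by (metis (no_types, lifting) image_subset_iff subsetI subset_antisym imageI)

  define F :: "nat \<Rightarrow> (('v + 'g) fword \<Rightarrow>\<^sub>0 'k) set" where "F n = A \<inter> deg_le n" for n
  have closed: "subst (shift d) p \<in> A" if "p \<in> A" for d p
    using that by (rule subst_closed) (rule shift_in_A)
  have in_F: "subst (shift d) p \<in> F n" if "p \<in> F n" for d p n
    using that closed subst_deg_le[OF _ _ shift_deg_le] by (auto simp: F_def)
  \<comment> \<open>The inverse of a shift is again a shift, so a set stable under all shifts is
    mapped onto itself. This gives both bijectivity on \<open>A\<close> and preservation of the
    filtration.\<close>
  have surj: "subst (shift c) ` S = S" if "\<And>d p. p \<in> S \<Longrightarrow> subst (shift d) p \<in> S" for S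
  proof (intro subset_antisym subsetI)
    fix p assume "p \<in> S"
    then show "p \<in> subst (shift c) ` S"
      using imageI[OF that[of p ?c'], of "subst (shift c)"] by (simp add: inverse)
  qed (use that in auto)
  have "alg_fam_iso (quot_alg (free_alg (gens G B)) Ik) (\<lambda>n. (\<lambda>p. Ik +>\<^bsub>free_alg (gens G B)\<^esub> p) ` F n)
    (quot_alg (free_alg (gens G B)) Il) (\<lambda>n. (\<lambda>p. Il +>\<^bsub>free_alg (gens G B)\<^esub> p) ` F n)"
  proof (rule quot_alg_iso[OF ring_free_alg])
    show "subst (shift c) \<in> ring_iso (free_alg (gens G B)) (free_alg (gens G B))"
    proof (rule ring_iso_memI)
      show "bij_betw (subst (shift c)) A A"
      proof (rule bij_betw_imageI)
        show "inj_on (subst (shift c)) A"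
          by (rule inj_onI) (metis subst_shift_inverse)
        show "subst (shift c) ` A = A"
          by (rule surj) (rule closed)
      qed
    qed (simp_all add: subst_add subst_mult closed)
    show "subst (shift c) ` F n = F n" for n
      by (rule surj) (rule in_F)
    show "Ik \<subseteq> A"
      using k.I_in_A by blast
  qed (simp_all add: subst_scale image F_def)
  then show ?thesis
    unfolding H_alg_def H_filt_eq F_def Ik_def Il_def .
qed

end

subsection \<open>Linear independence from the PBW property\<close>

text \<open>For a square matrix surjectivity implies injectivity. If \<open>f z\<close> were
  nonzero, row \<open>z\<close> would depend on the other rows, and fewer than \<open>card X\<close>
  vectors would span the \<open>card X\<close> independent unit vectors.\<close>

lemma square_system_injective:
  fixes m :: "'x \<Rightarrow> 'x \<Rightarrow> 'k::field"
  assumes X: "finite X"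
    and surj: "\<And>e. \<exists>f. \<forall>y\<in>X. (\<Sum>x\<in>X. f x * m x y) = e y"
    and zero: "\<And>y. y \<in> X \<Longrightarrow> (\<Sum>x\<in>X. f x * m x y) = 0" and "z \<in> X"
  shows "f z = 0"
proof (rule ccontr)
  assume nz: "f z \<noteq> 0"
  \<comment> \<open>Rows are turned into finitely supported functions, so that the bound on
    independent sets in a span applies to them.\<close>
  define row where "row x = (\<Sum>y\<in>X. Poly_Mapping.single y (m x y))" for x
  have lookup_row: "Poly_Mapping.lookup (row x) y = (if y \<in> X then m x y else 0)" for x y
    using X by (simp add: row_def lookup_sum lookup_single when_def sum.delta)
  let ?T = "row ` (X - {z})" and ?S = "(\<lambda>x. Poly_Mapping.single x (1::'k)) ` X"
  have "row z = (\<Sum>x\<in>X - {z}. pm_scale (- f x / f z) (row x))"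
  proof (rule poly_mapping_eqI)
    fix y
    have "f z * m z y + (\<Sum>x\<in>X - {z}. f x * m x y) = 0" if "y \<in> X"
      using zero[OF that] \<open>z \<in> X\<close> X by (simp add: sum.remove)
    then have "m z y = - (\<Sum>x\<in>X - {z}. f x * m x y) / f z" if "y \<in> X"
      using nz that by (simp add: field_simps eq_neg_iff_add_eq_0)
    then show "Poly_Mapping.lookup (row z) y
        = Poly_Mapping.lookup (\<Sum>x\<in>X - {z}. pm_scale (- f x / f z) (row x)) y"
      by (auto simp: lookup_row lookup_sum sum_divide_distrib sum_negf)
  qed
  then have "row z \<in> pm.span ?T"
    by (simp only:) (intro pm.span_sum pm.span_scale pm.span_base imageI)
  then have row: "row x \<in> pm.span ?T" if "x \<in> X" for x
    using that by (cases "x = z") (auto intro: pm.span_base)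
  have "?S \<subseteq> pm.span ?T"
  proof
    fix s assume "s \<in> ?S"
    then obtain y where y: "y \<in> X" "s = Poly_Mapping.single y 1" by auto
    obtain e where e: "\<forall>y'\<in>X. (\<Sum>x\<in>X. e x * m x y') = (if y' = y then 1 else 0)"
      using surj[of "\<lambda>y'. if y' = y then 1 else 0"] by blast
    have "s = (\<Sum>x\<in>X. pm_scale (e x) (row x))"
    proof (rule poly_mapping_eqI)
      fix k
      show "Poly_Mapping.lookup s k = Poly_Mapping.lookup (\<Sum>x\<in>X. pm_scale (e x) (row x)) k"
        using e y by (cases "k \<in> X") (auto simp: lookup_sum lookup_row lookup_single when_def)
    qed
    then show "s \<in> pm.span ?T"
      by (simp add: pm.span_sum pm.span_scale row)
  qed
  moreover have inj: "inj_on (\<lambda>x. Poly_Mapping.single x (1::'k)) X"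
    by (rule inj_onI) (metis lookup_single_eq lookup_single_not_eq one_neq_zero)
  moreover have "pm.independent ?S"
  proof (rule pm.independent_if_scalars_zero)
    fix u x assume sum: "(\<Sum>s\<in>?S. pm_scale (u s) s) = 0" and "x \<in> ?S"
    then obtain y where y: "y \<in> X" "x = Poly_Mapping.single y 1" by auto
    have "(\<Sum>s\<in>?S. pm_scale (u s) s) = (\<Sum>y\<in>X. Poly_Mapping.single y (u (Poly_Mapping.single y 1)))"
      by (subst sum.reindex[OF inj]) simp
    then have "Poly_Mapping.lookup (\<Sum>y\<in>X. Poly_Mapping.single y (u (Poly_Mapping.single y 1))) y = 0"
      using sum by simp
    then show "u x = 0"
      using y X by (simp add: lookup_sum lookup_single when_def sum.delta)
  qed (use X in simp)
  ultimately have "card ?S \<le> card ?T"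
    using pm.independent_span_bound[of ?T ?S] X by simp
  also have "\<dots> \<le> card (X - {z})"
    using X by (intro card_image_le) simp
  also have "\<dots> < card X"
    using X \<open>z \<in> X\<close> by (rule card_Diff1_less)
  also have "card X = card ?S"
    by (rule card_image[symmetric]) (rule inj)
  finally show False by simp
qed

section \<open>The associated graded algebra in terms of representatives\<close>

context skew_quotient
begin

abbreviation coset :: "(('v + 'g) fword \<Rightarrow>\<^sub>0 'k) \<Rightarrow> (('v + 'g) fword \<Rightarrow>\<^sub>0 'k) set" where
  "coset p \<equiv> I +>\<^bsub>free_alg (gens G B)\<^esub> p"

abbreviation H :: "('k, (('v + 'g) fword \<Rightarrow>\<^sub>0 'k) set) module" where
  "H \<equiv> quot_alg (free_alg (gens G B)) I"

lemma coset_eq: "coset p = {q. q \<approx> p}"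
proof -
  have "coset p = (\<lambda>i. i + p) ` I"
    by (auto simp: a_r_coset_def r_coset_def)
  also have "\<dots> = {q. q \<approx> p}"
    by (auto simp: eqv_def image_iff) (metis diff_add_cancel)
  finally show ?thesis .
qed

lemma coset_eqv: "p \<approx> q \<Longrightarrow> coset p = coset q"
  by (auto simp: coset_eq intro: eqv_trans eqv_sym)

lemma coset_0: "coset 0 = I"
  by (simp add: coset_eq eqv_def)

lemma set_add_image: "X <+>\<^bsub>R\<^esub> Z = (\<lambda>(x, z). x \<oplus>\<^bsub>R\<^esub> z) ` (X \<times> Z)"
  by (auto simp: set_add_def set_mult_def)

lemma set_add_eq: "X <+>\<^bsub>free_alg Y\<^esub> Z = (\<lambda>(x, z). x + z) ` (X \<times> Z)"
  by (simp add: set_add_image)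

lemma coset_add: "coset p <+>\<^bsub>free_alg (gens G B)\<^esub> coset q = coset (p + q)"
proof
  show "coset (p + q) \<subseteq> coset p <+>\<^bsub>free_alg (gens G B)\<^esub> coset q"
  proof
    fix r assume "r \<in> coset (p + q)"
    then have "r - q \<in> coset p" by (simp add: coset_eq eqv_def algebra_simps)
    moreover have "q \<in> coset q" by (simp add: coset_eq)
    ultimately have "(r - q, q) \<in> coset p \<times> coset q" by blast
    then have "(\<lambda>(x, z). x + z) (r - q, q) \<in> (\<lambda>(x, z). x + z) ` (coset p \<times> coset q)"
      by (rule imageI)
    then show "r \<in> coset p <+>\<^bsub>free_alg (gens G B)\<^esub> coset q"
      by (simp add: set_add_eq)
  qed
qed (auto simp: set_add_eq coset_eq eqv_add)

text \<open>Adding \<open>I\<close> matters for \<open>c = 0\<close>, where scaling collapses the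
  coset to the single element 0.\<close>

lemma coset_smult: "I <+>\<^bsub>free_alg (gens G B)\<^esub> pm_scale c ` coset p = coset (pm_scale c p)"
proof
  show "I <+>\<^bsub>free_alg (gens G B)\<^esub> pm_scale c ` coset p \<subseteq> coset (pm_scale c p)"
    by (auto simp: set_add_eq coset_eq)
      (metis add_0 coset_0 coset_eq eqv_add eqv_scale mem_Collect_eq)
  show "coset (pm_scale c p) \<subseteq> I <+>\<^bsub>free_alg (gens G B)\<^esub> pm_scale c ` coset p"
  proof
    fix r assume "r \<in> coset (pm_scale c p)"
    then have "(r - pm_scale c p, pm_scale c p) \<in> I \<times> pm_scale c ` coset p"
      by (auto simp: coset_eq eqv_def)
    then have "(\<lambda>(x, z). x + z) (r - pm_scale c p, pm_scale c p)
        \<in> (\<lambda>(x, z). x + z) ` (I \<times> pm_scale c ` coset p)"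
      by (rule imageI)
    then show "r \<in> I <+>\<^bsub>free_alg (gens G B)\<^esub> pm_scale c ` coset p"
      by (simp add: set_add_eq)
  qed
qed

lemma H_add: "coset p \<oplus>\<^bsub>H\<^esub> coset q = coset (p + q)"
  by (simp add: quot_alg_simps coset_add)

lemma H_smult: "c \<odot>\<^bsub>H\<^esub> coset p = coset (pm_scale c p)"
  by (simp add: quot_alg_simps coset_smult)

definition filt :: "nat \<Rightarrow> (('v + 'g) fword \<Rightarrow>\<^sub>0 'k) set" where
  "filt n = A \<inter> deg_le n"

definition filt_below :: "nat \<Rightarrow> (('v + 'g) fword \<Rightarrow>\<^sub>0 'k) set" where
  "filt_below n = (if n = 0 then {0} else filt (n - 1))"

lemma filt_closed:
  "p \<in> filt n \<Longrightarrow> q \<in> filt n \<Longrightarrow> p + q \<in> filt n" "p \<in> filt n \<Longrightarrow> q \<in> filt n \<Longrightarrow> p - q \<in> filt n"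
  "p \<in> filt n \<Longrightarrow> pm_scale c p \<in> filt n" "0 \<in> filt n"
  by (auto simp: filt_def intro: deg_le_closed deg_le_0_1)

lemma filt_sum: "(\<And>i. i \<in> S \<Longrightarrow> f i \<in> filt n) \<Longrightarrow> (\<Sum>i\<in>S. f i) \<in> filt n"
  by (auto simp: filt_def intro: deg_le_sum)

lemma filt_below_closed:
  "p \<in> filt_below n \<Longrightarrow> q \<in> filt_below n \<Longrightarrow> p + q \<in> filt_below n"
  "p \<in> filt_below n \<Longrightarrow> q \<in> filt_below n \<Longrightarrow> p - q \<in> filt_below n"
  "p \<in> filt_below n \<Longrightarrow> pm_scale c p \<in> filt_below n" "0 \<in> filt_below n"
  by (auto simp: filt_below_def filt_closed)

definition F :: "nat \<Rightarrow> (('v + 'g) fword \<Rightarrow>\<^sub>0 'k) set set" where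
  "F n = coset ` filt n"

lemma below_eq: "below H F n = coset ` filt_below n"
  by (simp add: below_def F_def filt_below_def quot_alg_simps coset_0)

text \<open>The class of \<open>p\<close> in the \<open>n\<close>-th graded piece. The quotient is
  taken twice, first by \<open>I\<close> and then by the lower filtration step, so the class is a
  set of cosets.\<close>

definition gr_class :: "nat \<Rightarrow> (('v + 'g) fword \<Rightarrow>\<^sub>0 'k) \<Rightarrow> (('v + 'g) fword \<Rightarrow>\<^sub>0 'k) set set" where
  "gr_class n p = (\<lambda>q. coset (q + p)) ` filt_below n"

lemma below_coset: "below H F n +>\<^bsub>H\<^esub> coset p = gr_class n p"
proof -
  have "S +>\<^bsub>H\<^esub> x = (\<lambda>y. y \<oplus>\<^bsub>H\<^esub> x) ` S" for S x
    by (auto simp: a_r_coset_def r_coset_def)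
  then show ?thesis
    by (simp add: below_eq gr_class_def image_image H_add)
qed

lemma gr_class_0: "gr_class n 0 = below H F n"
  by (simp add: gr_class_def below_eq)

text \<open>A lower-order term \<open>r\<close> only reparametrizes the coset. Proving one inclusion
  for all \<open>p\<close>, \<open>p'\<close>, \<open>r\<close> suffices, as the other follows with
  \<open>0 - r\<close>.\<close>

lemma gr_class_eqI:
  assumes "r \<in> filt_below n" "p \<approx> p' + r"
  shows "gr_class n p = gr_class n p'"
proof -
  have *: "gr_class n p \<subseteq> gr_class n p'" if "r \<in> filt_below n" "p \<approx> p' + r" for p p' r
  proof
    fix X assume "X \<in> gr_class n p"
    then obtain q where q: "q \<in> filt_below n" "X = coset (q + p)" by (auto simp: gr_class_def)
    have "q + p \<approx> (q + r) + p'"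
      using eqv_add[OF eqv_refl that(2), of q] by (simp add: ac_simps)
    then have "X = coset ((q + r) + p')"
      using q(2) coset_eqv by simp
    then show "X \<in> gr_class n p'"
      using q that by (auto simp: gr_class_def intro: filt_below_closed)
  qed
  have "p' \<approx> p + (0 - r)"
    using eqv_sym[OF eqv_diff[OF assms(2) eqv_refl[of r]]] by simp
  with * assms show ?thesis
    by (meson filt_below_closed(2,4) subset_antisym)
qed

lemma gr_class_add: "gr_class n p <+>\<^bsub>H\<^esub> gr_class n q = gr_class n (p + q)"
proof
  show "gr_class n p <+>\<^bsub>H\<^esub> gr_class n q \<subseteq> gr_class n (p + q)"
  proof
    fix X assume "X \<in> gr_class n p <+>\<^bsub>H\<^esub> gr_class n q"
    then obtain a b where ab: "a \<in> filt_below n" "b \<in> filt_below n" "X = coset ((a + p) + (b + q))"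
      by (auto simp: set_add_image gr_class_def H_add)
    then have "X = coset ((a + b) + (p + q))" by (simp add: ac_simps)
    with ab show "X \<in> gr_class n (p + q)"
      by (auto simp: gr_class_def intro: filt_below_closed)
  qed
  show "gr_class n (p + q) \<subseteq> gr_class n p <+>\<^bsub>H\<^esub> gr_class n q"
  proof
    fix X assume "X \<in> gr_class n (p + q)"
    then obtain a where a: "a \<in> filt_below n" "X = coset ((a + p) + (0 + q))"
      by (auto simp: gr_class_def ac_simps)
    have "(coset (a + p), coset (0 + q)) \<in> gr_class n p \<times> gr_class n q"
      using a(1) filt_below_closed(4) unfolding gr_class_def by blast
    then show "X \<in> gr_class n p <+>\<^bsub>H\<^esub> gr_class n q"
      unfolding set_add_image by (rule rev_image_eqI) (simp only: a(2) H_add split_conv)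
  qed
qed

lemma gr_class_smult:
  "below H F n <+>\<^bsub>H\<^esub> (\<lambda>X. c \<odot>\<^bsub>H\<^esub> X) ` gr_class n p = gr_class n (pm_scale c p)"
proof
  show "below H F n <+>\<^bsub>H\<^esub> (\<lambda>X. c \<odot>\<^bsub>H\<^esub> X) ` gr_class n p \<subseteq> gr_class n (pm_scale c p)"
  proof
    fix X assume "X \<in> below H F n <+>\<^bsub>H\<^esub> (\<lambda>X. c \<odot>\<^bsub>H\<^esub> X) ` gr_class n p"
    then obtain a b where ab: "a \<in> filt_below n" "b \<in> filt_below n"
        "X = coset (a + pm_scale c (b + p))"
      by (auto simp: set_add_image gr_class_def H_add H_smult below_eq)
    then have "X = coset ((a + pm_scale c b) + pm_scale c p)"
      by (simp add: pm.scale_right_distrib ac_simps)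
    with ab show "X \<in> gr_class n (pm_scale c p)"
      by (auto simp: gr_class_def intro: filt_below_closed)
  qed
  show "gr_class n (pm_scale c p) \<subseteq> below H F n <+>\<^bsub>H\<^esub> (\<lambda>X. c \<odot>\<^bsub>H\<^esub> X) ` gr_class n p"
  proof
    fix X assume "X \<in> gr_class n (pm_scale c p)"
    then obtain a where a: "a \<in> filt_below n" "X = coset (a + pm_scale c (0 + p))"
      by (auto simp: gr_class_def)
    have "(coset a, c \<odot>\<^bsub>H\<^esub> coset (0 + p)) \<in> below H F n \<times> (\<lambda>X. c \<odot>\<^bsub>H\<^esub> X) ` gr_class n p"
      using a(1) filt_below_closed(4) unfolding gr_class_def below_eq by blast
    then show "X \<in> below H F n <+>\<^bsub>H\<^esub> (\<lambda>X. c \<odot>\<^bsub>H\<^esub> X) ` gr_class n p"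
      unfolding set_add_image by (rule rev_image_eqI) (simp only: a(2) H_add H_smult split_conv)
  qed
qed

text \<open>The homogeneous element of degree \<open>n\<close> with leading representative
  \<open>p\<close>.\<close>

definition gr_elem :: "nat \<Rightarrow> (('v + 'g) fword \<Rightarrow>\<^sub>0 'k) \<Rightarrow> nat \<Rightarrow> (('v + 'g) fword \<Rightarrow>\<^sub>0 'k) set set" where
  "gr_elem n p m = gr_class m (if m = n then p else 0)"

lemma gr_comp_eq: "gr_comp H F n = gr_elem n ` filt n"
proof
  show "gr_comp H F n \<subseteq> gr_elem n ` filt n"
  proof
    fix x assume x: "x \<in> gr_comp H F n"
    then have "\<exists>a\<in>F n. x n = below H F n +>\<^bsub>H\<^esub> a"
      by (simp add: gr_comp_def gr_alg_def)
    then obtain p where p: "p \<in> filt n" "x n = gr_class n p"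
      by (auto simp: F_def below_coset)
    have "x = gr_elem n p"
      using x p by (intro ext) (simp add: gr_elem_def gr_comp_def gr_class_0)
    with p show "x \<in> gr_elem n ` filt n" by blast
  qed
  show "gr_elem n ` filt n \<subseteq> gr_comp H F n"
  proof
    fix x assume "x \<in> gr_elem n ` filt n"
    then obtain p where p: "p \<in> filt n" "x = gr_elem n p" by blast
    have "\<exists>a\<in>F m. x m = below H F m +>\<^bsub>H\<^esub> a" for m
      using p filt_closed(4)[of m]
      by (intro bexI[of _ "coset (if m = n then p else 0)"]) (auto simp: below_coset gr_elem_def F_def)
    moreover have off: "x m = below H F m" if "m \<noteq> n" for m
      using p that by (simp add: gr_elem_def gr_class_0)
    moreover have "finite {m. x m \<noteq> below H F m}"
      by (rule finite_subset[of _ "{n}"]) (use off in auto)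
    ultimately show "x \<in> gr_comp H F n"
      by (simp add: gr_comp_def gr_alg_def)
  qed
qed

lemma gr_elem_add: "gr_elem n p \<oplus>\<^bsub>gr_alg H F\<^esub> gr_elem n q = gr_elem n (p + q)"
  by (rule ext) (simp add: gr_alg_def gr_elem_def gr_class_add)

lemma gr_elem_smult: "c \<odot>\<^bsub>gr_alg H F\<^esub> gr_elem n p = gr_elem n (pm_scale c p)"
  by (rule ext) (simp add: gr_alg_def gr_elem_def gr_class_smult)

lemma gr_elem_eqI:
  assumes "r \<in> filt_below n" "p \<approx> p' + r"
  shows "gr_elem n p = gr_elem n p'"
  by (rule ext) (simp add: gr_elem_def gr_class_eqI[OF assms])

text \<open>The dimension count. The elements \<open>r x\<close> span degree \<open>n\<close> modulo
  lower terms, and there are as many of them as distinct monomials \<open>mon x\<close> of degree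
  \<open>n\<close> in the skew group algebra. Since \<open>h\<close> hits every combination of these
  monomials, the square matrix of coordinates of the \<open>r x\<close> is surjective, hence
  injective, and a relation among the \<open>r x\<close> modulo lower terms is trivial.\<close>

lemma gr_independent:
  fixes r :: "'x \<Rightarrow> (('v + 'g) fword \<Rightarrow>\<^sub>0 'k)" and mon :: "'x \<Rightarrow> 'g \<times> ('v \<Rightarrow>\<^sub>0 nat)"
  assumes iso: "alg_fam_iso (gr_alg H F) (gr_comp H F) (skew_alg G scale B act)
      (skew_comp G scale B act)"
    and X: "finite X" and r: "\<And>x. x \<in> X \<Longrightarrow> r x \<in> filt n"
    and mon: "inj_on mon X" "\<And>x. x \<in> X \<Longrightarrow> fst (mon x) \<in> carrier G"
      "\<And>x. x \<in> X \<Longrightarrow> Poly_Mapping.keys (snd (mon x)) \<subseteq> B" "\<And>x. x \<in> X \<Longrightarrow> mdeg (snd (mon x)) = n"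
    and span: "\<And>p. p \<in> filt n \<Longrightarrow> \<exists>f. \<exists>q\<in>filt_below n. p \<approx> (\<Sum>x\<in>X. pm_scale (f x) (r x)) + q"
    and q: "q \<in> filt_below n" "(\<Sum>x\<in>X. pm_scale (f x) (r x)) \<approx> q" and z: "z \<in> X"
  shows "f z = 0"
proof -
  obtain h where h: "h \<in> ring_iso (gr_alg H F) (skew_alg G scale B act)"
    and h_scale: "\<And>c x. x \<in> carrier (gr_alg H F) \<Longrightarrow>
      h (c \<odot>\<^bsub>gr_alg H F\<^esub> x) = c \<odot>\<^bsub>skew_alg G scale B act\<^esub> h x"
    and h_image: "\<And>n. h ` gr_comp H F n = skew_comp G scale B act n"
    using iso unfolding alg_fam_iso_def by blast
  \<comment> \<open>The coefficient at the monomial \<open>mon y\<close> of the image under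
    \<open>h\<close> of the class of \<open>p\<close>.\<close>
  define coord where "coord y p = Poly_Mapping.lookup (Poly_Mapping.lookup (h (gr_elem n p)) (fst (mon y)))
    (snd (mon y))" for y p
  have carrier: "gr_elem n p \<in> carrier (gr_alg H F)" if "p \<in> filt n" for p
    using that gr_comp_eq[of n] by (auto simp: gr_comp_def)
  have coord_add: "coord y (p + p') = coord y p + coord y p'" if "p \<in> filt n" "p' \<in> filt n" for y p p'
    using ring_iso_memE(3)[OF h carrier carrier, OF that]
    by (simp add: coord_def gr_elem_add skew_alg_def lookup_add)
  have coord_scale: "coord y (pm_scale c p) = c * coord y p" if "p \<in> filt n" for y c p
    using h_scale[OF carrier[OF that], of c]
    by (simp add: coord_def gr_elem_smult skew_alg_def Poly_Mapping.map.rep_eq when_def)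
  have coord_sum: "coord y (\<Sum>x\<in>X. pm_scale (f x) (r x)) = (\<Sum>x\<in>X. f x * coord y (r x))" for y f
    using X r
  proof (induction X)
    case empty
    show ?case using coord_scale[OF filt_closed(4), of y 0] by simp
  next
    case (insert x X)
    then have "(\<Sum>x\<in>X. pm_scale (f x) (r x)) \<in> filt n"
      by (intro filt_sum filt_closed) auto
    with insert show ?case
      by (simp add: coord_add coord_scale filt_closed)
  qed
  have coord_eqI: "coord y p = coord y p'" if "q \<in> filt_below n" "p \<approx> p' + q" for y p p' q
    using gr_elem_eqI[OF that] by (simp add: coord_def)
  show ?thesis
  proof (rule square_system_injective[OF X _ _ z])
    show "(\<Sum>x\<in>X. f x * coord y (r x)) = 0" for y
      using coord_eqI[of q "\<Sum>x\<in>X. pm_scale (f x) (r x)" 0 y] q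
        coord_scale[OF filt_closed(4), of y 0] by (simp add: coord_sum)
    show "\<exists>f. \<forall>y\<in>X. (\<Sum>x\<in>X. f x * coord y (r x)) = e y" for e
    proof -
      \<comment> \<open>The target with prescribed coefficients \<open>e\<close>; a preimage under
        \<open>h\<close>, expanded in the \<open>r x\<close>, solves the linear system.\<close>
      define s where "s = (\<Sum>x\<in>X. Poly_Mapping.single (fst (mon x))
        (Poly_Mapping.single (snd (mon x)) (e x)))"
      have lookup_s: "Poly_Mapping.lookup (Poly_Mapping.lookup s g) m
          = (\<Sum>x\<in>X. if mon x = (g, m) then e x else 0)" for g m
        unfolding s_def lookup_sum lookup_single
        by (auto simp: lookup_sum lookup_single when_def prod_eq_iff intro!: sum.cong)
      have *: "\<exists>x\<in>X. mon x = (g, m)"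
        if "Poly_Mapping.lookup (Poly_Mapping.lookup s g) m \<noteq> 0" for g m
      proof (rule ccontr)
        assume "\<not> ?thesis"
        then have "(\<Sum>x\<in>X. if mon x = (g, m) then e x else 0) = 0"
          by (intro sum.neutral) simp
        with that show False by (simp add: lookup_s)
      qed
      have monomial: "g \<in> carrier G \<and> Poly_Mapping.keys m \<subseteq> B \<and> mdeg m = n"
        if nz: "m \<in> Poly_Mapping.keys (Poly_Mapping.lookup s g)" for g m
      proof -
        obtain x where "x \<in> X" "mon x = (g, m)"
          using *[of g m] nz by (auto simp: in_keys_iff)
        then show ?thesis using mon(2-4)[of x] by simp
      qed
      have "Poly_Mapping.keys s \<subseteq> carrier G"
      proof
        fix g assume "g \<in> Poly_Mapping.keys s"
        then have "Poly_Mapping.lookup s g \<noteq> 0" by (simp add: in_keys_iff)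
        then obtain m where "m \<in> Poly_Mapping.keys (Poly_Mapping.lookup s g)"
          using poly_mapping_eqI[of "Poly_Mapping.lookup s g" 0] by (auto simp: in_keys_iff)
        then show "g \<in> carrier G" using monomial by blast
      qed
      then have "s \<in> skew_comp G scale B act n"
        using monomial by (simp add: skew_comp_def skew_alg_def Sym_def)
      then obtain p where p: "p \<in> filt n" "h (gr_elem n p) = s"
        using h_image[of n] gr_comp_eq[of n] by (metis (no_types, lifting) imageE)
      from span[OF p(1)] obtain f q where "q \<in> filt_below n"
        "p \<approx> (\<Sum>x\<in>X. pm_scale (f x) (r x)) + q" by blast
      then have "(\<Sum>x\<in>X. f x * coord y (r x)) = coord y p" for y
        using coord_eqI by (simp flip: coord_sum)
      moreover have "coord y p = e y" if "y \<in> X" for y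
      proof -
        have "coord y p = (\<Sum>x\<in>X. if x = y then e x else 0)"
          unfolding coord_def p(2) lookup_s using that inj_onD[OF mon(1)]
          by (intro sum.cong refl) auto
        then show ?thesis using that X by simp
      qed
      ultimately show ?thesis by (intro exI[of _ f] ballI) simp
    qed
  qed
qed

section \<open>Reduction of words to normal form\<close>

lemma gsum_single: "g \<in> carrier G \<Longrightarrow> gsum (\<lambda>a. if a = g then r else 0) = pm_scale r (grp g)"
  by (simp add: gsum_def if_distrib[of "\<lambda>c. pm_scale c _"] fin_G sum.delta cong: if_cong)

lemma word_Cons: "Poly_Mapping.single (FWord (x # ws)) (1::'k)
    = Poly_Mapping.single (FWord [x]) 1 * Poly_Mapping.single (FWord ws) 1"
  by (simp add: mult_single plus_fword_def)

text \<open>For a property \<open>Q\<close> that defines a subspace, the existence of normal forms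
  has to be checked on words only.\<close>

lemma filt_eqv_induct:
  assumes p: "p \<in> filt n"
    and word: "\<And>ws. set ws \<subseteq> gens G B \<Longrightarrow> vdeg (FWord ws) \<le> n \<Longrightarrow>
      \<exists>q. Q q \<and> Poly_Mapping.single (FWord ws) 1 \<approx> q"
    and Q_0: "Q 0" and Q_add: "\<And>q r. Q q \<Longrightarrow> Q r \<Longrightarrow> Q (q + r)"
    and Q_scale: "\<And>c q. Q q \<Longrightarrow> Q (pm_scale c q)"
  shows "\<exists>q. Q q \<and> p \<approx> q"
proof -
  have *: "\<exists>q. Q q \<and> (\<Sum>w\<in>S. pm_scale (Poly_Mapping.lookup p w) (Poly_Mapping.single w 1)) \<approx> q"
    if "finite S" "S \<subseteq> Poly_Mapping.keys p" for S
    using that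
  proof (induction S)
    case (insert w S)
    then obtain q where q: "Q q"
      "(\<Sum>w\<in>S. pm_scale (Poly_Mapping.lookup p w) (Poly_Mapping.single w 1)) \<approx> q" by auto
    have "set (letters w) \<subseteq> gens G B" "vdeg w \<le> n"
      using insert.prems p by (auto simp: filt_def mem_free_alg deg_le_def)
    with word[of "letters w"] obtain r where r: "Q r" "Poly_Mapping.single w 1 \<approx> r" by auto
    have "Q (pm_scale (Poly_Mapping.lookup p w) r + q)"
      by (intro Q_add Q_scale r q)
    moreover have "(\<Sum>w\<in>insert w S. pm_scale (Poly_Mapping.lookup p w) (Poly_Mapping.single w 1))
        \<approx> pm_scale (Poly_Mapping.lookup p w) r + q"
      unfolding sum.insert[OF insert.hyps] by (intro eqv_add eqv_scale r q)
    ultimately show ?case by blast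
  qed (use Q_0 in auto)
  have "(\<Sum>w\<in>Poly_Mapping.keys p. pm_scale (Poly_Mapping.lookup p w) (Poly_Mapping.single w 1)) = p"
    by (rule poly_mapping_eqI)
      (simp add: lookup_sum lookup_single when_def in_keys_iff sum.delta)
  with *[of "Poly_Mapping.keys p"] show ?thesis by simp
qed

text \<open>Such a word has group letters only. The empty word is the unit, congruent to
  \<open>grp \<one>\<close>, and each further letter translates the coefficients.\<close>

lemma word_eqv_gsum:
  "set ws \<subseteq> gens G B \<Longrightarrow> vdeg (FWord ws :: ('v + 'g) fword) = 0 \<Longrightarrow>
    \<exists>f. Poly_Mapping.single (FWord ws) 1 \<approx> gsum f"
proof (induction ws)
  case Nil
  have "Poly_Mapping.single (FWord []) 1 = (1 :: ('v + 'g) fword \<Rightarrow>\<^sub>0 'k)"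
    by (simp flip: zero_fword_def)
  then have "Poly_Mapping.single (FWord []) 1 \<approx> gsum (\<lambda>a. if a = \<one> then 1 else 0)"
    using eqv_sym[OF grp_one_eqv] by (simp add: gsum_single)
  then show ?case by blast
next
  case (Cons x ws)
  then obtain g where g: "x = Inr g" "g \<in> carrier G"
    by (auto simp: gens_def vdeg_def)
  with Cons obtain f where f: "Poly_Mapping.single (FWord ws) 1 \<approx> gsum f"
    by (auto simp: vdeg_def)
  have "Poly_Mapping.single (FWord (x # ws)) 1 = grp g * Poly_Mapping.single (FWord ws) 1"
    using g by (simp add: word_Cons[of "Inr g" ws] in_grp_def)
  also have "\<dots> \<approx> gsum (\<lambda>a. f (inv g \<otimes> a))"
    by (rule eqv_trans[OF eqv_mult_left[OF f] grp_gsum]) (simp_all add: g)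
  finally have "Poly_Mapping.single (FWord (x # ws)) 1 \<approx> gsum (\<lambda>a. f (inv g \<otimes> a))" .
  then show ?case by blast
qed

lemma filt_0_eqv_gsum:
  assumes "p \<in> filt 0"
  shows "\<exists>f. p \<approx> gsum f"
proof -
  have "\<exists>q. q \<in> range gsum \<and> p \<approx> q"
  proof (rule filt_eqv_induct[OF assms])
    show "\<exists>q. q \<in> range gsum \<and> Poly_Mapping.single (FWord ws) 1 \<approx> q"
      if "set ws \<subseteq> gens G B" "vdeg (FWord ws) \<le> 0" for ws
      using word_eqv_gsum[OF that(1)] that(2) by auto
    show "0 \<in> range gsum"
      by (rule range_eqI[of _ _ "\<lambda>a. 0"]) simp
    show "q + r \<in> range gsum" if "q \<in> range gsum" "r \<in> range gsum" for q r
      using that by (auto simp flip: gsum_add)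
    show "pm_scale c q \<in> range gsum" if "q \<in> range gsum" for c q
      using that by (auto simp flip: gsum_scale)
  qed
  then show ?thesis by blast
qed

text \<open>Normal form of the degree-one part: an element of \<open>V \<otimes> kG\<close> given by
  its \<open>V\<close>-valued coefficients at the group elements.\<close>

definition vec_gsum :: "('g \<Rightarrow> 'v) \<Rightarrow> (('v + 'g) fword \<Rightarrow>\<^sub>0 'k)" where
  "vec_gsum u = (\<Sum>h\<in>carrier G. vec (u h) * grp h)"

lemma vec_gsum_in_A [simp, intro]: "vec_gsum u \<in> A"
  by (auto simp: vec_gsum_def)

lemma vec_gsum_add: "vec_gsum (\<lambda>h. u h + v h) = vec_gsum u + vec_gsum v"
  by (simp add: vec_gsum_def vec_add distrib_right sum.distrib)

lemma vec_gsum_diff: "vec_gsum (\<lambda>h. u h - v h) = vec_gsum u - vec_gsum v"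
  by (simp add: vec_gsum_def vec_diff left_diff_distrib sum_subtractf)

lemma vec_gsum_scale: "vec_gsum (\<lambda>h. c *s u h) = pm_scale c (vec_gsum u)"
  by (simp add: vec_gsum_def vec_scale pm_scale_mult_left pm.scale_sum_right)

lemma vec_gsum_0 [simp]: "vec_gsum (\<lambda>h. 0) = 0"
  using vec_gsum_diff[of "\<lambda>h. 0" "\<lambda>h. 0"] by simp

lemma vec_mult_gsum: "vec v * gsum f = vec_gsum (\<lambda>h. f h *s v)"
  by (simp add: gsum_def vec_gsum_def sum_distrib_left pm_scale_mult_right pm_scale_mult_left
      vec_scale)

end

text \<open>The relations of the algebra with parameters \<lambda> and 0, together with its PBW
  property; \<open>l g v a\<close> stands for the coefficient of \<lambda>(g, v) at
  \<open>a\<close>.\<close>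

locale skew_presentation = skew_quotient G scale B act I
  for G :: "('g, 'm) monoid_scheme" (structure)
    and scale :: "'k::field \<Rightarrow> 'v::ab_group_add \<Rightarrow> 'v" (infixr \<open>*s\<close> 75)
    and B :: "'v set" and act :: "'g \<Rightarrow> 'v \<Rightarrow> 'v" and I :: "(('v + 'g) fword \<Rightarrow>\<^sub>0 'k) set" +
  fixes l :: "'g \<Rightarrow> 'v \<Rightarrow> 'g \<Rightarrow> 'k"
  assumes grp_vec: "g \<in> carrier G \<Longrightarrow>
      grp g * vec v \<approx> vec (act g v) * grp g + gsum (l g v)"
    and vec_vec: "vec v * vec w \<approx> vec w * vec v"
    and PBW: "alg_fam_iso (gr_alg H F) (gr_comp H F) (skew_alg G scale B act)
      (skew_comp G scale B act)"
begin

text \<open>Moving \<open>g\<close> past each vector gives a translated degree-one part and an error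
  in the group algebra coming from \<open>l\<close>.\<close>

lemma grp_vec_gsum:
  assumes g: "g \<in> carrier G"
  shows "\<exists>u f. grp g * vec_gsum v \<approx> vec_gsum u + gsum f"
proof -
  have "grp g * vec_gsum v = (\<Sum>h\<in>carrier G. (grp g * vec (v h)) * grp h)"
    by (simp add: vec_gsum_def sum_distrib_left mult.assoc)
  also have "\<dots> \<approx> (\<Sum>h\<in>carrier G. (vec (act g (v h)) * grp g + gsum (l g (v h))) * grp h)"
    using g by (intro eqv_sum eqv_mult_right grp_vec grp_in_A)
  also have "\<dots> = (\<Sum>h\<in>carrier G. vec (act g (v h)) * (grp g * grp h))
      + (\<Sum>h\<in>carrier G. gsum (l g (v h)) * grp h)"
    by (simp add: distrib_right sum.distrib mult.assoc)
  also have "\<dots> \<approx> (\<Sum>h\<in>carrier G. vec (act g (v h)) * grp (g \<otimes> h))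
      + (\<Sum>h\<in>carrier G. gsum (\<lambda>a. l g (v h) (a \<otimes> inv h)))"
    using g by (intro eqv_add eqv_sum eqv_mult_left grp_mult_eqv gsum_grp vec_in_A)
  also have "\<dots> = vec_gsum (\<lambda>a. act g (v (inv g \<otimes> a)))
      + gsum (\<lambda>a. \<Sum>h\<in>carrier G. l g (v h) (a \<otimes> inv h))"
  proof -
    have "(\<Sum>h\<in>carrier G. vec (act g (v h)) * grp (g \<otimes> h)) = vec_gsum (\<lambda>a. act g (v (inv g \<otimes> a)))"
      unfolding vec_gsum_def using g
      by (intro sum.reindex_bij_witness[of _ "\<lambda>a. inv g \<otimes> a" "\<lambda>h. g \<otimes> h"])
        (auto simp: G.m_assoc[symmetric])
    then show ?thesis by (simp add: gsum_sum)
  qed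
  finally show ?thesis by blast
qed

text \<open>If the first letter is a basis vector, the remaining word has degree zero and is already
  in normal form; if it is a group element, it is moved into the normal form of the rest.\<close>

lemma word_eqv_vec_gsum:
  "set ws \<subseteq> gens G B \<Longrightarrow> vdeg (FWord ws :: ('v + 'g) fword) \<le> 1 \<Longrightarrow>
    \<exists>u f. Poly_Mapping.single (FWord ws) 1 \<approx> vec_gsum u + gsum f"
proof (induction ws)
  case Nil
  then obtain f where "Poly_Mapping.single (FWord []) 1 \<approx> gsum f"
    using word_eqv_gsum[of "[]"] by (auto simp: vdeg_def)
  then have "Poly_Mapping.single (FWord []) 1 \<approx> vec_gsum (\<lambda>h. 0) + gsum f" by simp
  then show ?case by blast
next
  case (Cons x ws)
  show ?case
  proof (cases x)
    case (Inl b)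
    with Cons.prems have b: "b \<in> B" and ws: "set ws \<subseteq> gens G B" "vdeg (FWord ws) = 0"
      by (auto simp: gens_def vdeg_def)
    obtain f where f: "Poly_Mapping.single (FWord ws) 1 \<approx> gsum f"
      using word_eqv_gsum[OF ws] by blast
    have "Poly_Mapping.single (FWord (x # ws)) 1 = vec b * Poly_Mapping.single (FWord ws) 1"
      using b by (simp add: word_Cons[of "Inl b" ws] Inl vec_basis)
    also have "\<dots> \<approx> vec b * gsum f"
      by (intro eqv_mult_left f vec_in_A)
    also have "\<dots> = vec_gsum (\<lambda>h. f h *s b) + gsum (\<lambda>a. 0)"
      by (simp add: vec_mult_gsum)
    finally show ?thesis by blast
  next
    case (Inr g)
    with Cons.prems have g: "g \<in> carrier G" by (auto simp: gens_def)
    obtain u f where uf: "Poly_Mapping.single (FWord ws) 1 \<approx> vec_gsum u + gsum f"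
      using Cons Inr by (auto simp: vdeg_def)
    obtain u' f' where uf': "grp g * vec_gsum u \<approx> vec_gsum u' + gsum f'"
      using grp_vec_gsum[OF g] by blast
    have "Poly_Mapping.single (FWord (x # ws)) 1 = grp g * Poly_Mapping.single (FWord ws) 1"
      by (simp add: word_Cons[of "Inr g" ws] Inr in_grp_def)
    also have "\<dots> \<approx> grp g * (vec_gsum u + gsum f)"
      by (intro eqv_mult_left uf grp_in_A g)
    also have "\<dots> = grp g * vec_gsum u + grp g * gsum f"
      by (simp add: distrib_left)
    also have "\<dots> \<approx> (vec_gsum u' + gsum f') + gsum (\<lambda>a. f (inv g \<otimes> a))"
      by (intro eqv_add uf' grp_gsum g)
    also have "\<dots> = vec_gsum u' + gsum (\<lambda>a. f' a + f (inv g \<otimes> a))"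
      by (simp add: gsum_add add.assoc)
    finally show ?thesis by blast
  qed
qed

lemma filt_1_eqv_vec_gsum:
  assumes "p \<in> filt 1"
  shows "\<exists>u f. p \<approx> vec_gsum u + gsum f"
proof -
  have "\<exists>q. (\<exists>u f. q = vec_gsum u + gsum f) \<and> p \<approx> q"
  proof (rule filt_eqv_induct[OF assms])
    show "\<exists>q. (\<exists>u f. q = vec_gsum u + gsum f) \<and> Poly_Mapping.single (FWord ws) 1 \<approx> q"
      if "set ws \<subseteq> gens G B" "vdeg (FWord ws) \<le> 1" for ws
      using word_eqv_vec_gsum[OF that] by blast
    show "\<exists>u f. 0 = vec_gsum u + gsum f"
      by (intro exI[of _ "\<lambda>h. 0"]) simp
    show "\<exists>u f. q + r = vec_gsum u + gsum f"
      if "\<exists>u f. q = vec_gsum u + gsum f" "\<exists>u f. r = vec_gsum u + gsum f" for q r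
    proof -
      from that obtain u f u' f' where "q = vec_gsum u + gsum f" "r = vec_gsum u' + gsum f'"
        by blast
      then have "q + r = vec_gsum (\<lambda>h. u h + u' h) + gsum (\<lambda>a. f a + f' a)"
        by (simp add: vec_gsum_add gsum_add)
      then show ?thesis by blast
    qed
    show "\<exists>u f. pm_scale c q = vec_gsum u + gsum f" if "\<exists>u f. q = vec_gsum u + gsum f" for c q
    proof -
      from that obtain u f where "q = vec_gsum u + gsum f" by blast
      then have "pm_scale c q = vec_gsum (\<lambda>h. c *s u h) + gsum (\<lambda>a. c * f a)"
        by (simp add: vec_gsum_scale gsum_scale pm.scale_right_distrib)
      then show ?thesis by blast
    qed
  qed
  then show ?thesis by blast
qed

section \<open>Linear independence in degrees zero and one\<close>

lemma grp_in_deg_le: "grp g \<in> deg_le n"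
  by (auto simp: in_grp_def deg_le_def vdeg_def)

lemma gsum_in_filt: "gsum f \<in> filt n"
  by (auto simp: filt_def gsum_def intro!: deg_le_sum deg_le_closed(3) grp_in_deg_le)

lemma gsum_independent:
  assumes "gsum f \<approx> 0" "z \<in> carrier G"
  shows "f z = 0"
proof -
  \<comment> \<open>The only remainder below degree zero is 0, so the expansion must be exact modulo
    \<open>I\<close>.\<close>
  have span: "\<exists>f. \<exists>q\<in>filt_below 0. p \<approx> (\<Sum>x\<in>carrier G. pm_scale (f x) (grp x)) + q"
    if p: "p \<in> filt 0" for p
  proof -
    obtain f where "p \<approx> gsum f" using filt_0_eqv_gsum[OF p] by blast
    then show ?thesis
      by (intro exI[of _ f] bexI[of _ 0]) (simp_all add: gsum_def filt_below_def)
  qed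
  have sum: "(\<Sum>x\<in>carrier G. pm_scale (f x) (grp x)) \<approx> 0"
    using assms(1) by (simp only: gsum_def)
  have inj: "inj_on (\<lambda>g. (g, 0 :: 'v \<Rightarrow>\<^sub>0 nat)) (carrier G)"
    by (rule inj_onI) simp
  have grp: "grp x \<in> filt 0" if "x \<in> carrier G" for x
    using that by (simp add: filt_def grp_in_deg_le)
  show ?thesis
    by (rule gr_independent[OF PBW fin_G grp inj _ _ _ span filt_below_closed(4) sum assms(2)])
      (simp_all add: mdeg_def)
qed

text \<open>The dimension count in degree one, with the products \<open>b h\<close> against the
  monomials with group part \<open>h\<close> and polynomial part \<open>b\<close>. The summand
  \<open>gsum f\<close> lies in lower degree and so acts as the remainder.\<close>

lemma vec_gsum_independent:
  assumes "vec_gsum u + gsum f \<approx> 0" "z \<in> carrier G"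
  shows "u z = 0"
proof -
  have expand: "(\<Sum>(h, b)\<in>carrier G \<times> B. pm_scale (V.representation B (u h) b) (vec b * grp h))
      = vec_gsum u" for u
  proof -
    have "vec_gsum u
        = (\<Sum>h\<in>carrier G. (\<Sum>b\<in>B. pm_scale (V.representation B (u h) b) (vec b)) * grp h)"
      unfolding vec_gsum_def
      by (intro sum.cong refl arg_cong[where f = "\<lambda>p. p * grp _"] vec_expand vec_linear)
    then show ?thesis
      by (simp add: sum.cartesian_product[symmetric] sum_distrib_right pm_scale_mult_left)
  qed
  have vec_filt: "vec b * grp h \<in> filt 1" if "b \<in> B" "h \<in> carrier G" for b h
  proof -
    have "vec b \<in> deg_le 1" using that by (auto simp: vec_basis deg_le_def vdeg_def)
    from deg_le_mult[OF this grp_in_deg_le[of h 0]] that show ?thesis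
      by (simp add: filt_def)
  qed
  define mon where "mon x = (fst x, Poly_Mapping.single (snd x) (1 :: nat))" for x :: "'g \<times> 'v"
  define r where "r x = vec (snd x) * grp (fst x)" for x :: "'g \<times> 'v"
  define rep where "rep u x = V.representation B (u (fst x)) (snd x)" for u and x :: "'g \<times> 'v"
  have expand: "(\<Sum>x\<in>carrier G \<times> B. pm_scale (rep u x) (r x)) = vec_gsum u" for u
    using expand[of u] by (simp add: split_def rep_def r_def)
  have fin: "finite (carrier G \<times> B)"
    using fin_G V.finite_Basis by simp
  have r_filt: "r x \<in> filt 1" if "x \<in> carrier G \<times> B" for x
    using that vec_filt unfolding r_def by auto
  have "Poly_Mapping.single b (1::nat) \<noteq> Poly_Mapping.single b' 1" if "b \<noteq> b'" for b b' :: 'v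
    using that by (metis lookup_single_eq lookup_single_not_eq one_neq_zero)
  then have inj: "inj_on mon (carrier G \<times> B)"
    unfolding mon_def by (intro inj_onI) (metis prod.collapse prod.inject)
  have mon: "fst (mon x) \<in> carrier G" "Poly_Mapping.keys (snd (mon x)) \<subseteq> B" "mdeg (snd (mon x)) = 1"
    if "x \<in> carrier G \<times> B" for x
    using that by (auto simp: mon_def mdeg_def)
  have below: "gsum f \<in> filt_below 1" for f
    by (simp add: filt_below_def gsum_in_filt)
  have span: "\<exists>f. \<exists>q\<in>filt_below 1. p \<approx> (\<Sum>x\<in>carrier G \<times> B. pm_scale (f x) (r x)) + q"
    if p: "p \<in> filt 1" for p
    using filt_1_eqv_vec_gsum[OF p] below by (metis expand)
  have "gsum (\<lambda>a. - 1 * f a) = - gsum f"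
    unfolding gsum_scale by simp
  then have sum: "(\<Sum>x\<in>carrier G \<times> B. pm_scale (rep u x) (r x)) \<approx> gsum (\<lambda>a. - 1 * f a)"
    unfolding expand using assms(1) by (simp only: eqv_def diff_minus_eq_add diff_zero)
  have "rep u x = 0" if "x \<in> carrier G \<times> B" for x
    by (rule gr_independent[OF PBW fin r_filt inj mon span below sum that])
  then have "V.representation B (u z) b = 0" if "b \<in> B" for b
    using that assms(2) by (auto simp: rep_def)
  then show ?thesis
    using V.sum_representation_eq[of B "u z" B]
    by (simp add: V.independent_Basis V.span_Basis V.finite_Basis)
qed

text \<open>The cocycle identity
  \<open>\<lambda>(g h, v) = \<lambda>(g, h v) h + g \<lambda>(h, v)\<close>, found by moving
  \<open>g h\<close> past \<open>v\<close> at once and in two steps and comparing coefficients in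
  the group algebra.\<close>

lemma l_mult:
  assumes "g \<in> carrier G" "h \<in> carrier G" "a \<in> carrier G"
  shows "l (g \<otimes> h) v a = l g (act h v) (a \<otimes> inv h) + l h v (inv g \<otimes> a)"
proof -
  note gh = assms(1,2)
  have "vec (act (g \<otimes> h) v) * grp (g \<otimes> h) + gsum (l (g \<otimes> h) v) \<approx> grp (g \<otimes> h) * vec v"
    using gh by (intro eqv_sym[OF grp_vec]) simp
  also have "\<dots> \<approx> grp g * grp h * vec v"
    using gh by (intro eqv_mult_right eqv_sym[OF grp_mult_eqv]) auto
  also have "grp g * grp h * vec v = grp g * (grp h * vec v)"
    by (rule mult.assoc)
  also have "\<dots> \<approx> grp g * (vec (act h v) * grp h + gsum (l h v))"
    using gh by (intro eqv_mult_left grp_vec) auto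
  also have "\<dots> = grp g * vec (act h v) * grp h + grp g * gsum (l h v)"
    by (simp add: distrib_left mult.assoc)
  also have "\<dots> \<approx> (vec (act g (act h v)) * grp g + gsum (l g (act h v))) * grp h
      + gsum (\<lambda>a. l h v (inv g \<otimes> a))"
    using gh by (intro eqv_add eqv_mult_right grp_vec grp_gsum) auto
  also have "\<dots> = vec (act g (act h v)) * (grp g * grp h) + gsum (l g (act h v)) * grp h
      + gsum (\<lambda>a. l h v (inv g \<otimes> a))"
    by (simp add: distrib_right mult.assoc)
  also have "\<dots> \<approx> vec (act g (act h v)) * grp (g \<otimes> h) + gsum (\<lambda>a. l g (act h v) (a \<otimes> inv h))
      + gsum (\<lambda>a. l h v (inv g \<otimes> a))"
    using gh by (intro eqv_add eqv_mult_left grp_mult_eqv gsum_grp eqv_refl) auto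
  finally have "gsum (\<lambda>a. l (g \<otimes> h) v a - (l g (act h v) (a \<otimes> inv h) + l h v (inv g \<otimes> a))) \<approx> 0"
    using gh by (simp add: eqv_def gsum_diff gsum_add act_mult)
  from gsum_independent[OF this assms(3)] show ?thesis by simp
qed

text \<open>Compare \<open>g v w\<close> with \<open>g w v\<close>: the quadratic parts agree, and
  the claim equates the \<open>V\<close>-valued coefficients at \<open>h\<close> in degree
  one.\<close>

lemma l_symmetric:
  assumes g: "g \<in> carrier G" and "h \<in> carrier G"
  shows "l g v h *s (act h w - act g w) = l g w h *s (act h v - act g v)"
proof -
  \<comment> \<open>First \<open>g\<close> is moved past \<open>v\<close>, then \<open>g\<close> and
    every \<open>h\<close> occurring in \<lambda>(g, v) are moved past \<open>w\<close>.\<close>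
  have expand: "grp g * (vec v * vec w) \<approx> vec (act g v) * vec (act g w) * grp g
      + (vec_gsum (\<lambda>h. l g w h *s act g v + l g v h *s act h w)
        + gsum (\<lambda>a. \<Sum>h\<in>carrier G. l g v h * l h w a))" for v w
  proof -
    have "grp g * (vec v * vec w) = grp g * vec v * vec w"
      by (simp add: mult.assoc)
    also have "\<dots> \<approx> (vec (act g v) * grp g + gsum (l g v)) * vec w"
      using g by (intro eqv_mult_right grp_vec) auto
    also have "\<dots> = vec (act g v) * (grp g * vec w)
        + (\<Sum>h\<in>carrier G. pm_scale (l g v h) (grp h * vec w))"
      by (simp add: distrib_right mult.assoc gsum_def sum_distrib_right pm_scale_mult_left)
    also have "\<dots> \<approx> vec (act g v) * (vec (act g w) * grp g + gsum (l g w))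
        + (\<Sum>h\<in>carrier G. pm_scale (l g v h) (vec (act h w) * grp h + gsum (l h w)))"
      using g by (intro eqv_add eqv_sum eqv_scale eqv_mult_left grp_vec) auto
    also have "\<dots> = vec (act g v) * vec (act g w) * grp g
        + (vec_gsum (\<lambda>h. l g w h *s act g v + l g v h *s act h w)
          + gsum (\<lambda>a. \<Sum>h\<in>carrier G. l g v h * l h w a))"
      by (simp add: distrib_left mult.assoc vec_mult_gsum vec_gsum_add gsum_sum gsum_scale
          pm.scale_right_distrib sum.distrib add.assoc)
        (simp add: vec_gsum_def vec_scale pm_scale_mult_left)
    finally show ?thesis .
  qed
  have "vec (act g v) * vec (act g w) * grp g
      + (vec_gsum (\<lambda>h. l g w h *s act g v + l g v h *s act h w)
        + gsum (\<lambda>a. \<Sum>h\<in>carrier G. l g v h * l h w a)) \<approx> grp g * (vec v * vec w)"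
    by (rule eqv_sym[OF expand])
  also have "\<dots> \<approx> grp g * (vec w * vec v)"
    using g by (intro eqv_mult_left vec_vec) auto
  also have "\<dots> \<approx> vec (act g w) * vec (act g v) * grp g
      + (vec_gsum (\<lambda>h. l g v h *s act g w + l g w h *s act h v)
        + gsum (\<lambda>a. \<Sum>h\<in>carrier G. l g w h * l h v a))"
    by (rule expand)
  \<comment> \<open>Reordering the quadratic term makes it coincide with the one on the other side,
    so that an equation of degree at most one remains.\<close>
  also have "\<dots> \<approx> vec (act g v) * vec (act g w) * grp g
      + (vec_gsum (\<lambda>h. l g v h *s act g w + l g w h *s act h v)
        + gsum (\<lambda>a. \<Sum>h\<in>carrier G. l g w h * l h v a))"
    using g by (intro eqv_add eqv_mult_right vec_vec eqv_refl) auto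
  finally have "vec_gsum (\<lambda>h. (l g w h *s act g v + l g v h *s act h w)
        - (l g v h *s act g w + l g w h *s act h v))
      + gsum (\<lambda>a. (\<Sum>h\<in>carrier G. l g v h * l h w a) - (\<Sum>h\<in>carrier G. l g w h * l h v a)) \<approx> 0"
    by (simp add: eqv_def vec_gsum_diff gsum_diff algebra_simps)
  from vec_gsum_independent[OF this assms(2)] show ?thesis
    by (simp add: V.scale_right_diff_distrib algebra_simps)
qed

text \<open>The coefficient of \<gamma>(v) at \<open>a\<close>. Since \<open>g\<^sup>-\<^sup>1 (g v)
  g = v + \<lambda>(g\<^sup>-\<^sup>1, g v) g\<close>, the sum averages these corrections over
  \<open>G\<close>.\<close>

definition average :: "'v \<Rightarrow> 'g \<Rightarrow> 'k" where
  "average v a = (\<Sum>g\<in>carrier G. l (inv g) (act g v) (a \<otimes> inv g)) / of_nat (order G)"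

text \<open>Averaging exhibits the cocycle as a coboundary, namely
  \<open>\<lambda>(h, v) = \<gamma>(h v) h - h \<gamma>(v)\<close>. The cocycle identity splits off
  one copy of \<open>l h v a\<close> for each group element, and the order of \<open>G\<close> can
  be divided out.\<close>

lemma average_act:
  assumes order: "of_nat (order G) \<noteq> (0 :: 'k)" and h: "h \<in> carrier G" and a: "a \<in> carrier G"
  shows "l h v a = average (act h v) (a \<otimes> inv h) - average v (inv h \<otimes> a)"
proof -
  have cancel: "h \<otimes> (inv h \<otimes> x) = x" if "x \<in> carrier G" for x
    using h that by (simp add: G.m_assoc[symmetric])
  \<comment> \<open>Replacing \<open>g\<close> by \<open>g \<otimes> inv h\<close> absorbs the
    action of \<open>h\<close> on \<open>v\<close> and puts \<open>h\<close> into the first argument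
    of \<open>l\<close>.\<close>
  have "(\<Sum>g\<in>carrier G. l (inv g) (act g (act h v)) (a \<otimes> inv h \<otimes> inv g))
      = (\<Sum>g\<in>carrier G. l (h \<otimes> inv g) (act g v) (a \<otimes> inv g))"
    using h a
    by (intro sum.reindex_bij_witness[of _ "\<lambda>g. g \<otimes> inv h" "\<lambda>g. g \<otimes> h"])
      (auto simp: G.m_assoc G.inv_mult_group act_mult cancel)
  also have "\<dots> = (\<Sum>g\<in>carrier G. l h v a + l (inv g) (act g v) (inv h \<otimes> a \<otimes> inv g))"
  proof (rule sum.cong[OF refl])
    fix g assume g: "g \<in> carrier G"
    have "act (inv g) (act g v) = v"
      using g act_mult[of "inv g" g v] by (simp add: act_one)
    then show "l (h \<otimes> inv g) (act g v) (a \<otimes> inv g)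
        = l h v a + l (inv g) (act g v) (inv h \<otimes> a \<otimes> inv g)"
      using g h a by (simp add: l_mult G.m_assoc)
  qed
  also have "\<dots> = of_nat (order G) * l h v a
      + (\<Sum>g\<in>carrier G. l (inv g) (act g v) (inv h \<otimes> a \<otimes> inv g))"
    by (simp add: sum.distrib order_def)
  finally show ?thesis
    using order by (simp add: average_def field_simps)
qed

text \<open>Each summand is \<open>l_symmetric\<close> for \<open>inv g\<close> and
  \<open>a \<otimes> inv g\<close> at the vectors \<open>act g v\<close> and \<open>act g w\<close>,
  where the group elements cancel to leave \<open>a\<close> and the identity.\<close>

lemma average_symmetric:
  assumes a: "a \<in> carrier G"
  shows "average v a *s (act a w - w) = average w a *s (act a v - v)"
proof -
  have "l (inv g) (act g v) (a \<otimes> inv g) *s (act a w - w)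
      = l (inv g) (act g w) (a \<otimes> inv g) *s (act a v - v)" if g: "g \<in> carrier G" for g v w
  proof -
    have "act (a \<otimes> inv g) (act g v) = act a v" "act (inv g) (act g v) = v" for v
      using a g by (simp_all add: act_mult[symmetric] G.m_assoc act_one)
    then show ?thesis
      using l_symmetric[of "inv g" "a \<otimes> inv g" "act g v" "act g w"] a g by simp
  qed
  then have "(\<Sum>g\<in>carrier G. l (inv g) (act g v) (a \<otimes> inv g) *s (act a w - w))
      = (\<Sum>g\<in>carrier G. l (inv g) (act g w) (a \<otimes> inv g) *s (act a v - v))"
    by (intro sum.cong refl)
  then show ?thesis
    by (simp add: average_def divide_inverse mult.commute flip: V.scale_scale V.scale_sum_left)
qed

lemma average_add:
  assumes "\<And>g v w a. g \<in> carrier G \<Longrightarrow> l g (v + w) a = l g v a + l g w a"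
  shows "average (v + w) a = average v a + average w a"
  by (simp add: average_def act_add assms sum.distrib add_divide_distrib)

lemma average_scale:
  assumes "\<And>g r v a. g \<in> carrier G \<Longrightarrow> l g (r *s v) a = r * l g v a"
  shows "average (r *s v) a = r * average v a"
  by (simp add: average_def act_scale assms sum_distrib_left)

end

theorem theorem4p1:
  fixes G :: "('g, 'm) monoid_scheme"
    and scale :: "'k::field \<Rightarrow> 'v::ab_group_add \<Rightarrow> 'v"
    and B :: "'v set"
    and act :: "'g \<Rightarrow> 'v \<Rightarrow> 'v"
    and lam :: "('g \<Rightarrow>\<^sub>0 'k) \<Rightarrow> 'v \<Rightarrow> ('g \<Rightarrow>\<^sub>0 'k)"
  assumes "group G"
    and "finite (carrier G)"
    and "finite_dimensional_vector_space scale B"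
    and "group_action G (UNIV :: 'v set) act"
    and "\<And>g. g \<in> carrier G \<Longrightarrow> Vector_Spaces.linear scale scale (act g)"
    and "CHAR('k) = 0 \<or> \<not> CHAR('k) dvd order G"
    and "lambda_param G scale lam"
    and "PBW G scale B act lam (\<lambda>_ _. 0)"
  shows "\<exists>kap. kappa_param G scale kap \<and>
    alg_fam_iso
      (H_alg G scale B act (\<lambda>_ _. 0) kap) (H_filt G scale B act (\<lambda>_ _. 0) kap)
      (H_alg G scale B act lam (\<lambda>_ _. 0)) (H_filt G scale B act lam (\<lambda>_ _. 0))"
proof -
  interpret skew_setting G scale B act
    using assms by (simp add: skew_setting_def skew_setting_axioms_def)
  define Il where "Il = rel_ideal G scale B act lam (\<lambda>_ _. 0)"
  define l where "l g v a = Poly_Mapping.lookup (lam (Poly_Mapping.single g 1) v) a" for g v a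
  have single_kG: "Poly_Mapping.single g 1 \<in> kG G" if "g \<in> carrier G" for g
    using that by (simp add: kG_def)
  have lam: "lam (Poly_Mapping.single g 1) v \<in> kG G" if "g \<in> carrier G" for g v
    using assms(7) single_kG[OF that] by (auto simp: lambda_param_def)
  have lam_lin: "Vector_Spaces.linear scale pm_scale (lam (Poly_Mapping.single g 1))"
    if "g \<in> carrier G" for g
    using assms(7) single_kG[OF that] by (auto simp: lambda_param_def)
  have zero: "0 \<in> kG G" "in_kG 0 = 0" by (simp_all add: kG_def in_kG_def)
  interpret q: skew_quotient G scale B act Il
    unfolding Il_def by (rule skew_quotient_rel_ideal) (simp_all add: lam zero)
  have rel: "relators G scale B act lam (\<lambda>_ _. 0) \<subseteq> Il"
    unfolding Il_def by (rule skew_quotient_rel_ideal) (simp_all add: lam zero)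
  interpret skew_presentation G scale B act Il l
  proof
    show "q.eqv (grp g * vec v) (vec (act g v) * grp g + gsum (l g v))" if "g \<in> carrier G" for g v
      using subsetD[OF rel relator_grp_vec[OF that]]
      by (simp add: q.eqv_def in_kG_eq_gsum[OF lam[OF that]] l_def[abs_def] diff_diff_eq)
    show "q.eqv (vec v * vec w) (vec w * vec v)" for v w
      using subsetD[OF rel relator_vec_vec] by (simp add: q.eqv_def zero)
    have "q.F = H_filt G scale B act lam (\<lambda>_ _. 0)"
      by (rule ext) (simp add: H_filt_eq q.F_def q.filt_def flip: Il_def)
    then show "alg_fam_iso (gr_alg q.H q.F) (gr_comp q.H q.F) (skew_alg G scale B act)
        (skew_comp G scale B act)"
      using assms(8) by (simp add: PBW_def H_alg_def Il_def)
  qed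
  \<comment> \<open>Positivity settles characteristic 0, where divisibility of the order by
    \<open>CHAR('k)\<close> would force the order to be 0.\<close>
  have "0 < order G"
    using fin_G G.one_closed by (auto simp: order_def card_gt_0_iff)
  then have order: "of_nat (order G) \<noteq> (0 :: 'k)"
    using assms(6) by (auto simp: of_nat_eq_0_iff_char_dvd)
  have add: "average (v + w) a = average v a + average w a" for v w a
    by (rule average_add) (use lam_lin in \<open>simp add: l_def Vector_Spaces.linear_iff lookup_add\<close>)
  have scale: "average (scale r v) a = r * average v a" for r v a
    by (rule average_scale) (use lam_lin in \<open>simp add: l_def Vector_Spaces.linear_iff\<close>)
  show ?thesis
  proof (intro exI[of _ "commutator_param average"] conjI)
    show "kappa_param G scale (commutator_param average)"
      by (rule kappa_param_commutator) (simp_all add: add scale)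
    show "alg_fam_iso
      (H_alg G scale B act (\<lambda>_ _. 0) (commutator_param average))
      (H_filt G scale B act (\<lambda>_ _. 0) (commutator_param average))
      (H_alg G scale B act lam (\<lambda>_ _. 0)) (H_filt G scale B act lam (\<lambda>_ _. 0))"
      by (rule commutator_param_iso)
        (use average_act[OF order] in \<open>simp_all add: lam add scale average_symmetric l_def\<close>)
  qed
qed

end
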